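(* Let $R$ be a commutative valuation ring with infinite residue field $k$, and let $f:A=\prod_{i\in I} A_i\to B$ be a surjective homomorphism from a direct product of $R$-algebras to an $R$-algebra $B$ that is torsion-free as an $R$-module. Let $\mathrm{rk}_R(B)$ denote the rank of $B$ as an $R$-module, i.e., the common cardinality of all maximal $R$-linearly independent subsets of $B$. Suppose further that at least one of the following holds: (i) $\mathrm{rk}_R(B)<\mathrm{card}(k)$ and $\mathrm{card}(I)\leq\mathrm{card}(k)$; or (ii) $\mathrm{rk}_R(B)<2^{\aleph_0}$ and $\mathrm{card}(I)=\aleph_0$. Then $$B\ =\ f(A_{\mathrm{fin}})+Z(B),$$ and $f$ can be written as the sum of a homomorphism $f_1:A\to B$ that factors through the projection to a finite subproduct of $\prod_{i\in I} A_i$, and a homomorphism $f_0:A\to B$ with image in $Z(B)$.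
   Context: A commutative valuation ring is an integral domain $R$ such that for any two elements one divides the other. An $R$-algebra is an $R$-module with an $R$-bilinear multiplication, not assumed associative or unital; homomorphisms are $R$-algebra homomorphisms. $Z(B)=\{x\in B\mid xB=Bx=\{0\}\}$. For $a=(a_i)\in A=\prod_{i\in I}A_i$, $\mathrm{supp}(a)=\{i\in I\mid a_i\neq 0\}$, and $A_{\mathrm{fin}}=\{a\in A\mid \mathrm{supp}(a)\text{ is finite}\}$. A finite subproduct is a product of finitely many of the $A_i$. *)

theory Defs
  imports "HOL-Algebra.Algebra"
begin

unbundle cardinal_syntax

locale valuation_ring = domain R for R (structure) +
  assumes divides_total:
    "\<lbrakk>a \<in> carrier R; b \<in> carrier R\<rbrakk> \<Longrightarrow> a divides b \<or> b divides a"

definition residue_field :: "('r, 'm) ring_scheme \<Rightarrow> 'r set ring" where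
  "residue_field R = R Quot (carrier R - Units R)"

lemma (in valuation_ring) maximalideal_nonunits: "maximalideal (carrier R - Units R) R"
proof -
  have unit_left: "a \<in> Units R" if "a \<in> carrier R" "x \<in> carrier R" "x \<otimes> a \<in> Units R" for a x
    using that unit_factor m_comm by metis
  have closed: "x \<otimes> a \<in> carrier R - Units R" if "a \<in> carrier R - Units R" "x \<in> carrier R" for a x
    using that unit_left by blast
  have sum: "a \<oplus> b \<in> carrier R - Units R"
    if a: "a \<in> carrier R - Units R" and b: "b \<in> carrier R - Units R" for a b
  proof -
    from a b have ca: "a \<in> carrier R" and cb: "b \<in> carrier R" by auto
    from divides_total[OF ca cb] show ?thesis
    proof
      assume "a divides b"
      then obtain c where c: "c \<in> carrier R" "b = a \<otimes> c" by (auto simp: factor_def)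
      then have "a \<oplus> b = (\<one> \<oplus> c) \<otimes> a" using ca by (simp add: l_distr m_comm[of a c])
      then show ?thesis using closed[OF a, of "\<one> \<oplus> c"] c by simp
    next
      assume "b divides a"
      then obtain c where c: "c \<in> carrier R" "a = b \<otimes> c" by (auto simp: factor_def)
      then have "a \<oplus> b = (c \<oplus> \<one>) \<otimes> b" using cb by (simp add: l_distr m_comm[of b c])
      then show ?thesis using closed[OF b, of "c \<oplus> \<one>"] c by simp
    qed
  qed
  have zero: "\<zero> \<in> carrier R - Units R" by (auto simp: Units_def)
  have neg: "\<ominus> a \<in> carrier R - Units R" if "a \<in> carrier R - Units R" for a
    using closed[OF that, of "\<ominus> \<one>"] that by (simp add: l_minus)
  have sg: "subgroup (carrier R - Units R) (add_monoid R)"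
  proof (rule add.subgroupI)
    show "carrier R - Units R \<noteq> {}" using zero by blast
    show "\<And>a. a \<in> carrier R - Units R \<Longrightarrow> \<ominus> a \<in> carrier R - Units R"
      using neg .
  qed (use sum in auto)
  have id: "ideal (carrier R - Units R) R"
  proof (rule idealI[OF ring_axioms sg])
    fix a x assume a: "a \<in> carrier R - Units R" and x: "x \<in> carrier R"
    show "x \<otimes> a \<in> carrier R - Units R" using closed a x by blast
    then show "a \<otimes> x \<in> carrier R - Units R" using a x m_comm[of a x] by simp
  qed
  show ?thesis
  proof (rule maximalidealI[OF id])
    show "carrier R \<noteq> carrier R - Units R" by auto
    fix J assume J: "ideal J R" "carrier R - Units R \<subseteq> J" "J \<subseteq> carrier R"
    show "J = carrier R - Units R \<or> J = carrier R"
    proof (cases "J \<inter> Units R = {}")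
      case True then show ?thesis using J by blast
    next
      case False
      then obtain u where u: "u \<in> J" "u \<in> Units R" by blast
      then have "\<one> \<in> J" using ideal.I_l_closed[OF J(1) u(1), of "inv u"] by simp
      then show ?thesis using ideal.one_imp_carrier[OF J(1)] by blast
    qed
  qed
qed

text \<open>The multiplication of an algebra is the \<open>mult\<close> field of the module record;
  the \<open>one\<close> field carries no meaning, as algebras are not assumed unital.\<close>

locale nonassoc_algebra = module R M for R (structure) and M (structure) +
  assumes mult_closed: "\<lbrakk>x \<in> carrier M; y \<in> carrier M\<rbrakk> \<Longrightarrow> x \<otimes>\<^bsub>M\<^esub> y \<in> carrier M"
    and mult_add_left: "\<lbrakk>x \<in> carrier M; y \<in> carrier M; z \<in> carrier M\<rbrakk> \<Longrightarrow>
      (x \<oplus>\<^bsub>M\<^esub> y) \<otimes>\<^bsub>M\<^esub> z = x \<otimes>\<^bsub>M\<^esub> z \<oplus>\<^bsub>M\<^esub> y \<otimes>\<^bsub>M\<^esub> z"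
    and mult_add_right: "\<lbrakk>x \<in> carrier M; y \<in> carrier M; z \<in> carrier M\<rbrakk> \<Longrightarrow>
      x \<otimes>\<^bsub>M\<^esub> (y \<oplus>\<^bsub>M\<^esub> z) = x \<otimes>\<^bsub>M\<^esub> y \<oplus>\<^bsub>M\<^esub> x \<otimes>\<^bsub>M\<^esub> z"
    and mult_smult_left: "\<lbrakk>r \<in> carrier R; x \<in> carrier M; y \<in> carrier M\<rbrakk> \<Longrightarrow>
      (r \<odot>\<^bsub>M\<^esub> x) \<otimes>\<^bsub>M\<^esub> y = r \<odot>\<^bsub>M\<^esub> (x \<otimes>\<^bsub>M\<^esub> y)"
    and mult_smult_right: "\<lbrakk>r \<in> carrier R; x \<in> carrier M; y \<in> carrier M\<rbrakk> \<Longrightarrow>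
      x \<otimes>\<^bsub>M\<^esub> (r \<odot>\<^bsub>M\<^esub> y) = r \<odot>\<^bsub>M\<^esub> (x \<otimes>\<^bsub>M\<^esub> y)"

definition alg_hom ::
  "('r, 'm) ring_scheme \<Rightarrow> ('r, 'a) module \<Rightarrow> ('r, 'b) module \<Rightarrow> ('a \<Rightarrow> 'b) set" where
  "alg_hom R M N = {h \<in> carrier M \<rightarrow> carrier N.
     (\<forall>x\<in>carrier M. \<forall>y\<in>carrier M. h (x \<oplus>\<^bsub>M\<^esub> y) = h x \<oplus>\<^bsub>N\<^esub> h y) \<and>
     (\<forall>r\<in>carrier R. \<forall>x\<in>carrier M. h (r \<odot>\<^bsub>M\<^esub> x) = r \<odot>\<^bsub>N\<^esub> h x) \<and>
     (\<forall>x\<in>carrier M. \<forall>y\<in>carrier M. h (x \<otimes>\<^bsub>M\<^esub> y) = h x \<otimes>\<^bsub>N\<^esub> h y)}"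

definition alg_prod :: "'i set \<Rightarrow> ('i \<Rightarrow> ('r, 'a) module) \<Rightarrow> ('r, 'i \<Rightarrow> 'a) module" where
  "alg_prod I A =
    \<lparr>carrier = (\<Pi>\<^sub>E i\<in>I. carrier (A i)),
     monoid.mult = (\<lambda>x y. \<lambda>i\<in>I. x i \<otimes>\<^bsub>A i\<^esub> y i),
     monoid.one = (\<lambda>i\<in>I. \<one>\<^bsub>A i\<^esub>),
     ring.zero = (\<lambda>i\<in>I. \<zero>\<^bsub>A i\<^esub>),
     ring.add = (\<lambda>x y. \<lambda>i\<in>I. x i \<oplus>\<^bsub>A i\<^esub> y i),
     module.smult = (\<lambda>r x. \<lambda>i\<in>I. r \<odot>\<^bsub>A i\<^esub> x i)\<rparr>"

lemma nonassoc_algebra_alg_prod: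
  fixes R (structure)
  assumes R: "cring R" and A: "\<And>i. i \<in> I \<Longrightarrow> nonassoc_algebra R (A i)"
  shows "nonassoc_algebra R (alg_prod I A)"
proof -
  note m = nonassoc_algebra.axioms(1)[OF A]
  note g = module.axioms(2)[OF m]
  note mon = abelian_group.axioms(1)[OF g]
  have "abelian_group (alg_prod I A)"
  proof (rule abelian_groupI)
    fix x assume x: "x \<in> carrier (alg_prod I A)"
    show "\<exists>y\<in>carrier (alg_prod I A). y \<oplus>\<^bsub>alg_prod I A\<^esub> x = \<zero>\<^bsub>alg_prod I A\<^esub>"
      by (rule bexI[of _ "\<lambda>i\<in>I. \<ominus>\<^bsub>A i\<^esub> x i"])
        (use x g in \<open>auto simp: alg_prod_def PiE_iff abelian_group.l_neg
          intro!: ext abelian_group.a_inv_closed\<close>)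
  next
    fix x y assume "x \<in> carrier (alg_prod I A)" "y \<in> carrier (alg_prod I A)"
    then show "x \<oplus>\<^bsub>alg_prod I A\<^esub> y = y \<oplus>\<^bsub>alg_prod I A\<^esub> x"
      by (auto simp: alg_prod_def PiE_iff fun_eq_iff intro!: abelian_monoid.a_comm[OF mon])
  qed (auto simp: alg_prod_def PiE_iff extensional_def fun_eq_iff
      abelian_monoid.a_closed[OF mon] abelian_monoid.a_assoc[OF mon]
      abelian_monoid.l_zero[OF mon] abelian_monoid.zero_closed[OF mon])
  then have "module R (alg_prod I A)"
    by (rule moduleI[OF R])
      (auto simp: alg_prod_def PiE_iff extensional_def fun_eq_iff
        module.smult_closed[OF m] module.smult_l_distr[OF m] module.smult_r_distr[OF m]
        module.smult_assoc1[OF m] module.smult_one[OF m])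
  then show ?thesis
    by (rule nonassoc_algebra.intro, unfold_locales)
      (auto simp: alg_prod_def PiE_iff extensional_def fun_eq_iff
        nonassoc_algebra.mult_closed[OF A] nonassoc_algebra.mult_add_left[OF A]
        nonassoc_algebra.mult_add_right[OF A] nonassoc_algebra.mult_smult_left[OF A]
        nonassoc_algebra.mult_smult_right[OF A])
qed

definition alg_supp :: "'i set \<Rightarrow> ('i \<Rightarrow> ('r, 'a) module) \<Rightarrow> ('i \<Rightarrow> 'a) \<Rightarrow> 'i set" where
  "alg_supp I A a = {i \<in> I. a i \<noteq> \<zero>\<^bsub>A i\<^esub>}"

definition alg_fin :: "'i set \<Rightarrow> ('i \<Rightarrow> ('r, 'a) module) \<Rightarrow> ('i \<Rightarrow> 'a) set" where
  "alg_fin I A = {a \<in> carrier (alg_prod I A). finite (alg_supp I A a)}"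

definition total_annihilator :: "('r, 'b) module \<Rightarrow> 'b set" where
  "total_annihilator B =
    {x \<in> carrier B. \<forall>y\<in>carrier B. x \<otimes>\<^bsub>B\<^esub> y = \<zero>\<^bsub>B\<^esub> \<and> y \<otimes>\<^bsub>B\<^esub> x = \<zero>\<^bsub>B\<^esub>}"

definition torsion_free :: "('r, 'm) ring_scheme \<Rightarrow> ('r, 'b) module \<Rightarrow> bool" where
  "torsion_free R M \<longleftrightarrow>
    (\<forall>r\<in>carrier R. \<forall>x\<in>carrier M. r \<odot>\<^bsub>M\<^esub> x = \<zero>\<^bsub>M\<^esub> \<longrightarrow> r = \<zero>\<^bsub>R\<^esub> \<or> x = \<zero>\<^bsub>M\<^esub>)"

definition lin_indep :: "('r, 'm) ring_scheme \<Rightarrow> ('r, 'b) module \<Rightarrow> 'b set \<Rightarrow> bool" where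
  "lin_indep R M S \<longleftrightarrow> S \<subseteq> carrier M \<and>
    (\<forall>F c. finite F \<and> F \<subseteq> S \<and> c \<in> F \<rightarrow> carrier R \<and>
       (\<Oplus>\<^bsub>M\<^esub>x\<in>F. c x \<odot>\<^bsub>M\<^esub> x) = \<zero>\<^bsub>M\<^esub> \<longrightarrow> (\<forall>x\<in>F. c x = \<zero>\<^bsub>R\<^esub>))"

definition max_lin_indep :: "('r, 'm) ring_scheme \<Rightarrow> ('r, 'b) module \<Rightarrow> 'b set \<Rightarrow> bool" where
  "max_lin_indep R M S \<longleftrightarrow>
    lin_indep R M S \<and> (\<forall>T. lin_indep R M T \<and> S \<subseteq> T \<longrightarrow> T = S)"

lemma ex_max_lin_indep:
  assumes "abelian_monoid M"
  shows "\<exists>S. max_lin_indep R M S"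
proof -
  have "\<exists>S\<in>Collect (lin_indep R M). \<forall>T\<in>Collect (lin_indep R M). S \<subseteq> T \<longrightarrow> T = S"
  proof (rule subset_Zorn_nonempty)
    have "lin_indep R M {}" by (auto simp: lin_indep_def)
    then show "Collect (lin_indep R M) \<noteq> {}" by blast
    fix C assume C: "C \<noteq> {}" "subset.chain (Collect (lin_indep R M)) C"
    have "lin_indep R M (\<Union>C)"
      unfolding lin_indep_def
    proof (intro conjI allI impI)
      show "\<Union>C \<subseteq> carrier M" using C unfolding subset.chain_def lin_indep_def by blast
      fix F c
      assume F: "finite F \<and> F \<subseteq> \<Union>C \<and> c \<in> F \<rightarrow> carrier R \<and>
        (\<Oplus>\<^bsub>M\<^esub>x\<in>F. c x \<odot>\<^bsub>M\<^esub> x) = \<zero>\<^bsub>M\<^esub>"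
      then obtain S where "S \<in> C" "F \<subseteq> S"
        using finite_subset_Union_chain[of F C "Collect (lin_indep R M)"] C by blast
      then show "\<forall>x\<in>F. c x = \<zero>\<^bsub>R\<^esub>"
        using F C by (auto simp: subset.chain_def lin_indep_def subset_iff)
    qed
    then show "\<Union>C \<in> Collect (lin_indep R M)" by simp
  qed
  then show ?thesis by (auto simp: max_lin_indep_def)
qed

text \<open>Over a domain all maximal linearly independent sets are equipollent,
  so the choice below is immaterial up to \<open>=o\<close>.\<close>

definition module_rank :: "('r, 'm) ring_scheme \<Rightarrow> ('r, 'b) module \<Rightarrow> 'b rel" where
  "module_rank R M = |SOME S. max_lin_indep R M S|"

end

theory Submission
  imports Defs
begin

text \<open>For \<open>a \<in> A\<close> the \<open>R\<close>-linear map \<open>u \<mapsto> f (u a)\<close> from \<open>R\<^sup>I\<close> to \<open>B\<close> kills some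
  \<open>u\<close> almost all of whose coordinates are units. Indeed there are more than \<open>rk B\<close> elements of
  \<open>k\<^sup>I\<close> all of whose nontrivial linear combinations have finitely many zeros: in case (i) the
  functions \<open>1 / (c - x\<^sub>i)\<close> for \<open>c \<in> k\<close> and distinct \<open>x\<^sub>i\<close>, in case (ii) the branches of a
  binary tree labelled generically. Their lifts have linearly dependent images in \<open>B\<close>, and since
  \<open>B\<close> is torsion-free and \<open>R\<close> is a valuation ring, the relation can be scaled to have a
  coefficient \<open>1\<close>. If \<open>u\<close> is invertible off \<open>J\<close>, then \<open>f (a b) = f (u a) f (u\<^sup>-\<^sup>1 b) = 0\<close>
  for all \<open>b\<close> supported on \<open>I - J\<close>, so the part of \<open>a\<close> off \<open>J\<close> is mapped into \<open>Z(B)\<close>. Finally, only finitely many factors have an image with nonzero products, and these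
  give a set \<open>J\<close> that works for all \<open>a\<close>.\<close>

section \<open>Functions with few zeros in linear combinations\<close>

text \<open>With \<open>u\<close> and \<open>w\<close> standing for the inverses of
  \<open>c - x\<close> and \<open>c - y\<close>, this is the identity (d-x)/(c-x) = (d-y)/(c-y) +
  (x-y)(d-c)/((c-x)(c-y)), multiplied by \<open>a\<close>. The products that will equal 1 are left
  in place, which makes it a polynomial identity for arbitrary \<open>u\<close> and
  \<open>w\<close>.\<close>

lemma (in cring) cross_difference:
  assumes "a \<in> carrier R" "c \<in> carrier R" "d \<in> carrier R" "x \<in> carrier R" "y \<in> carrier R"
    "u \<in> carrier R" "w \<in> carrier R"
  shows "(d \<ominus> x) \<otimes> (a \<otimes> (u \<otimes> ((c \<ominus> y) \<otimes> w))) =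
    (d \<ominus> y) \<otimes> (a \<otimes> (w \<otimes> ((c \<ominus> x) \<otimes> u))) \<oplus> (x \<ominus> y) \<otimes> ((a \<otimes> ((d \<ominus> c) \<otimes> w)) \<otimes> u)"
  using assms unfolding a_minus_def by algebra

text \<open>Multiplying the relation at \<open>x\<close> by \<open>c0 - x\<close> and subtracting two instances
  eliminates the pole \<open>c0\<close>.\<close>

lemma (in field) finite_zeros_partial_fractions:
  assumes "finite F" "F \<subseteq> carrier R" "infinite T" "T \<subseteq> carrier R - F" "a \<in> F \<rightarrow> carrier R"
    and "\<And>x. x \<in> T \<Longrightarrow> (\<Oplus>c\<in>F. a c \<otimes> inv (c \<ominus> x)) = \<zero>"
  shows "\<forall>c\<in>F. a c = \<zero>"
  using assms
proof (induction F arbitrary: a T)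
  case empty then show ?case by simp
next
  case (insert c0 F)
  have inv_props: "inv (c \<ominus> x) \<in> carrier R \<and> (c \<ominus> x) \<otimes> inv (c \<ominus> x) = \<one>"
    if "c \<in> insert c0 F" "x \<in> T" for c x
  proof -
    have "c \<in> carrier R" "x \<in> carrier R" "c \<noteq> x" using that insert.prems by auto
    then have "c \<ominus> x \<in> Units R" by (simp add: field_Units)
    then show ?thesis by simp
  qed
  have [simp]: "c0 \<in> carrier R" "a c0 \<in> carrier R" using insert.prems by auto
  have [simp]: "x \<in> carrier R" if "x \<in> T" for x using that insert.prems by auto
  have carr [simp]: "c \<in> carrier R" "a c \<in> carrier R" if "c \<in> F" for c using that insert.prems by auto
  have ic [simp]: "inv (c \<ominus> x) \<in> carrier R" if "c \<in> insert c0 F" "x \<in> T" for c x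
    using inv_props that by blast
  define s where "s x = (\<Oplus>c\<in>F. a c \<otimes> inv (c \<ominus> x))" for x
  have sc [simp]: "s x \<in> carrier R" if "x \<in> T" for x
    unfolding s_def using that by (intro finsum_closed) auto
  \<comment> \<open>The right-hand side does not involve \<open>x\<close>, so subtracting the
    instances at two points of \<open>T\<close> removes the unknown \<open>a c0\<close>.\<close>
  have s0: "(c0 \<ominus> x) \<otimes> s x = \<ominus> a c0" if x: "x \<in> T" for x
  proof -
    have "a c0 \<otimes> inv (c0 \<ominus> x) \<oplus> s x = \<zero>"
      using insert.prems(5)[OF x] insert.hyps x unfolding s_def
      by (subst (asm) finsum_insert) auto
    then have "s x = \<ominus> (a c0 \<otimes> inv (c0 \<ominus> x))"
      using x by (metis sc ic carr \<open>a c0 \<in> carrier R\<close> insertI1 m_closed minus_equality minus_minus)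
    then have "(c0 \<ominus> x) \<otimes> s x = \<ominus> (a c0 \<otimes> ((c0 \<ominus> x) \<otimes> inv (c0 \<ominus> x)))"
      using x by (simp add: r_minus m_lcomm)
    then show ?thesis using inv_props[of c0 x] x by simp
  qed
  obtain x0 where x0: "x0 \<in> T" using insert.prems(2) infinite_imp_nonempty by blast
  \<comment> \<open>\<open>b c\<close> is what remains of the coefficient at the pole
    \<open>c\<close> after this subtraction and division by \<open>x - x0\<close>. The factor next
    to \<open>a c\<close> is nonzero because \<open>c\<close> differs from \<open>c0\<close>, so
    \<open>b c = 0\<close> gives back \<open>a c = 0\<close>.\<close>
  define b where "b c = a c \<otimes> ((c0 \<ominus> c) \<otimes> inv (c \<ominus> x0))" for c
  have bc [simp]: "b c \<in> carrier R" if "c \<in> F" for c using that x0 by (simp add: b_def)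
  have "\<forall>c\<in>F. b c = \<zero>"
  proof (rule insert.IH)
    show "F \<subseteq> carrier R" "infinite (T - {x0})" "T - {x0} \<subseteq> carrier R - F" "b \<in> F \<rightarrow> carrier R"
      using insert.prems by auto
    fix x assume "x \<in> T - {x0}"
    then have x: "x \<in> T" "x \<noteq> x0" by auto
    have termwise: "(c0 \<ominus> x) \<otimes> (a c \<otimes> inv (c \<ominus> x)) =
        (c0 \<ominus> x0) \<otimes> (a c \<otimes> inv (c \<ominus> x0)) \<oplus> (x \<ominus> x0) \<otimes> (b c \<otimes> inv (c \<ominus> x))" if c: "c \<in> F" for c
    proof -
      define u w where "u = inv (c \<ominus> x)" and "w = inv (c \<ominus> x0)"
      have uw: "u \<in> carrier R" "w \<in> carrier R" "(c \<ominus> x) \<otimes> u = \<one>" "(c \<ominus> x0) \<otimes> w = \<one>"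
        using inv_props c x x0 unfolding u_def w_def by auto
      have "(c0 \<ominus> x) \<otimes> (a c \<otimes> u) = (c0 \<ominus> x) \<otimes> (a c \<otimes> (u \<otimes> ((c \<ominus> x0) \<otimes> w)))"
        using uw by simp
      also have "\<dots> = (c0 \<ominus> x0) \<otimes> (a c \<otimes> (w \<otimes> ((c \<ominus> x) \<otimes> u))) \<oplus>
          (x \<ominus> x0) \<otimes> ((a c \<otimes> ((c0 \<ominus> c) \<otimes> w)) \<otimes> u)"
        using c x x0 uw(1,2) by (intro cross_difference) auto
      finally show ?thesis using uw by (simp add: u_def w_def b_def)
    qed
    define S where "S = (\<Oplus>c\<in>F. b c \<otimes> inv (c \<ominus> x))"
    have Sc [simp]: "S \<in> carrier R" unfolding S_def using x by (intro finsum_closed) auto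
    have "(c0 \<ominus> x) \<otimes> s x = (\<Oplus>c\<in>F. (c0 \<ominus> x) \<otimes> (a c \<otimes> inv (c \<ominus> x)))"
      unfolding s_def using x insert.hyps by (intro finsum_rdistr) auto
    also have "\<dots> = (\<Oplus>c\<in>F. (c0 \<ominus> x0) \<otimes> (a c \<otimes> inv (c \<ominus> x0)) \<oplus> (x \<ominus> x0) \<otimes> (b c \<otimes> inv (c \<ominus> x)))"
      using termwise x x0 by (intro finsum_cong') auto
    also have "\<dots> = (\<Oplus>c\<in>F. (c0 \<ominus> x0) \<otimes> (a c \<otimes> inv (c \<ominus> x0))) \<oplus>
        (\<Oplus>c\<in>F. (x \<ominus> x0) \<otimes> (b c \<otimes> inv (c \<ominus> x)))"
      using x x0 by (intro finsum_addf) auto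
    also have "(\<Oplus>c\<in>F. (c0 \<ominus> x0) \<otimes> (a c \<otimes> inv (c \<ominus> x0))) = (c0 \<ominus> x0) \<otimes> s x0"
      unfolding s_def using x0 insert.hyps by (intro finsum_rdistr[symmetric]) auto
    also have "(\<Oplus>c\<in>F. (x \<ominus> x0) \<otimes> (b c \<otimes> inv (c \<ominus> x))) = (x \<ominus> x0) \<otimes> S"
      unfolding S_def using x x0 insert.hyps by (intro finsum_rdistr[symmetric]) auto
    finally have "(x \<ominus> x0) \<otimes> S = \<zero>"
      using s0[OF x(1)] s0[OF x0] x x0 by (simp add: add.l_cancel_one)
    then show "(\<Oplus>c\<in>F. b c \<otimes> inv (c \<ominus> x)) = \<zero>"
      using x x0 by (auto simp: integral_iff S_def)
  qed
  then have aF: "a c = \<zero>" if "c \<in> F" for c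
  proof -
    have "a c = \<zero> \<or> c0 \<ominus> c = \<zero> \<or> inv (c \<ominus> x0) = \<zero>"
      using \<open>\<forall>c\<in>F. b c = \<zero>\<close> that x0 by (auto simp: b_def integral_iff)
    moreover have "c0 \<ominus> c \<noteq> \<zero>" using insert.hyps(2) that by auto
    moreover have "inv (c \<ominus> x0) \<noteq> \<zero>" using inv_props[of c x0] that x0 by auto
    ultimately show ?thesis by blast
  qed
  have "s x0 = \<zero>" unfolding s_def using aF x0 by (intro add.finprod_one_eqI) auto
  then have "\<ominus> a c0 = \<zero>" using s0[OF x0] x0 by simp
  then have "a c0 = \<zero>" using \<open>a c0 \<in> carrier R\<close> by (metis minus_minus minus_zero)
  then show ?case using aF by auto
qed

text \<open>Nontrivial combinations must have few zeros, rather than just be nonzero: over the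
  residue field their zeros are the coordinates where lifted scalars fail to be units. A family
  indexed by \<open>Y\<close> is used instead of a set of functions, so that the size of
  \<open>Y\<close> can be compared with the rank directly.\<close>

definition cofinitely_independent ::
  "('k, 'm) ring_scheme \<Rightarrow> 'x set \<Rightarrow> 'i set \<Rightarrow> ('x \<Rightarrow> 'i \<Rightarrow> 'k) \<Rightarrow> bool" where
  "cofinitely_independent K Y I v \<longleftrightarrow> (\<forall>x\<in>Y. \<forall>i\<in>I. v x i \<in> carrier K) \<and>
    (\<forall>F a. finite F \<and> F \<subseteq> Y \<and> a \<in> F \<rightarrow> carrier K \<and> (\<exists>x\<in>F. a x \<noteq> \<zero>\<^bsub>K\<^esub>) \<longrightarrow>
      finite {i\<in>I. (\<Oplus>\<^bsub>K\<^esub>x\<in>F. a x \<otimes>\<^bsub>K\<^esub> v x i) = \<zero>\<^bsub>K\<^esub>})"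

text \<open>Infinitely many zeros of a combination would give infinitely many points
  \<open>p i\<close> at which a sum of partial fractions with poles in \<open>F\<close> vanishes,
  and this forces all coefficients to be zero.\<close>

lemma (in field) ex_cofinitely_independent_carrier:
  assumes p: "inj_on p I" "p ` I \<subseteq> carrier R"
  shows "\<exists>v. cofinitely_independent R (carrier R) I v"
proof -
  \<comment> \<open>The value at the pole is a mere default: since \<open>p\<close> is injective, a
    finite set \<open>F\<close> of poles meets only finitely many indices, and these are discarded
    below.\<close>
  define v where "v c i = (if c = p i then \<zero> else inv (c \<ominus> p i))" for c i
  have v: "v c i \<in> carrier R" if "c \<in> carrier R" "i \<in> I" for c i
  proof (cases "c = p i")
    case False
    then have "c \<ominus> p i \<in> Units R" using that p by (auto simp add: field_Units)
    then show ?thesis using False by (simp add: v_def)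
  qed (simp add: v_def)
  have "finite {i\<in>I. (\<Oplus>c\<in>F. a c \<otimes> v c i) = \<zero>}" (is "finite ?Z")
    if F: "finite F" "F \<subseteq> carrier R" "a \<in> F \<rightarrow> carrier R" and nz: "\<exists>c\<in>F. a c \<noteq> \<zero>" for F a
  proof (rule ccontr)
    assume inf: "infinite ?Z"
    have "infinite (p ` ?Z - F)"
      using inf F(1) p(1) by (simp add: finite_image_iff inj_on_def)
    moreover have "p ` ?Z - F \<subseteq> carrier R - F" using p by auto
    moreover have "(\<Oplus>c\<in>F. a c \<otimes> inv (c \<ominus> x)) = \<zero>" if x: "x \<in> p ` ?Z - F" for x
    proof -
      from x obtain i where i: "i \<in> ?Z" "x = p i" "p i \<notin> F" by auto
      have "(\<Oplus>c\<in>F. a c \<otimes> inv (c \<ominus> x)) = (\<Oplus>c\<in>F. a c \<otimes> v c i)"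
      proof (rule finsum_cong')
        show "(\<lambda>c. a c \<otimes> v c i) \<in> F \<rightarrow> carrier R"
        proof
          fix c assume c: "c \<in> F"
          then have "a c \<in> carrier R" "v c i \<in> carrier R" using F(2,3) v[of c i] i(1) by blast+
          then show "a c \<otimes> v c i \<in> carrier R" by simp
        qed
        show "a c \<otimes> inv (c \<ominus> x) = a c \<otimes> v c i" if "c \<in> F" for c
          using that i by (auto simp: v_def)
      qed simp
      then show ?thesis using i by simp
    qed
    ultimately have "\<forall>c\<in>F. a c = \<zero>" using F by (intro finite_zeros_partial_fractions) auto
    then show False using nz by blast
  qed
  then have "cofinitely_independent R (carrier R) I v"
    unfolding cofinitely_independent_def by (auto simp: v)
  then show ?thesis by (intro exI[of _ v])
qed

section \<open>Generic labellings of the binary tree\<close>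

text \<open>A finite-dimensional space over an infinite field is not covered by finitely many
  hyperplanes. To avoid one more form \<open>\<psi>\<close>, the vector \<open>r\<close> is moved
  along a coordinate \<open>d\<close> with \<open>\<psi> d\<close> nonzero: each form with nonzero
  coefficient at \<open>d\<close> excludes a single step \<open>t\<close>, and the others keep their
  nonzero values.\<close>

lemma (in field) ex_avoiding_linear_forms:
  assumes inf: "infinite (carrier R)" and D: "finite D" and "finite \<Phi>"
    and "\<And>\<phi>. \<phi> \<in> \<Phi> \<Longrightarrow> \<phi> \<in> D \<rightarrow> carrier R \<and> (\<exists>s\<in>D. \<phi> s \<noteq> \<zero>)"
  shows "\<exists>r\<in>D \<rightarrow> carrier R. \<forall>\<phi>\<in>\<Phi>. (\<Oplus>s\<in>D. \<phi> s \<otimes> r s) \<noteq> \<zero>"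
  using assms(3,4)
proof (induction \<Phi>)
  case empty then show ?case by auto
next
  case (insert \<psi> \<Phi>)
  then obtain r where r: "r \<in> D \<rightarrow> carrier R" "\<And>\<phi>. \<phi> \<in> \<Phi> \<Longrightarrow> (\<Oplus>s\<in>D. \<phi> s \<otimes> r s) \<noteq> \<zero>" by auto
  obtain d where d: "d \<in> D" "\<psi> d \<noteq> \<zero>" using insert.prems by blast
  have form: "\<phi> \<in> D \<rightarrow> carrier R" if "\<phi> \<in> insert \<psi> \<Phi>" for \<phi> using insert.prems that by blast
  define ev where "ev \<phi> = (\<Oplus>s\<in>D. \<phi> s \<otimes> r s)" for \<phi>
  have evc: "ev \<phi> \<in> carrier R" if "\<phi> \<in> insert \<psi> \<Phi>" for \<phi>
    unfolding ev_def using form[OF that] r(1) by (intro finsum_closed) auto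
  define bad where "bad = (\<Union>\<phi>\<in>{\<phi>\<in>insert \<psi> \<Phi>. \<phi> d \<noteq> \<zero>}. {\<ominus> ev \<phi> \<otimes> inv (\<phi> d)})"
  have "finite bad" unfolding bad_def using insert.hyps by auto
  then obtain t where t: "t \<in> carrier R" "t \<notin> bad" using inf by (meson finite_subset subsetI)
  define r' where "r' s = (if s = d then r s \<oplus> t else r s)" for s
  have r'c: "r' \<in> D \<rightarrow> carrier R" using r(1) t(1) by (simp add: r'_def Pi_iff)
  have "(\<Oplus>s\<in>D. \<phi> s \<otimes> r' s) \<noteq> \<zero>" if \<phi>: "\<phi> \<in> insert \<psi> \<Phi>" for \<phi>
  proof -
    have pc: "\<phi> s \<in> carrier R" "r s \<in> carrier R" if "s \<in> D" for s using form[OF \<phi>] r(1) that by auto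
    have "(\<Oplus>s\<in>D. \<phi> s \<otimes> r' s) = (\<Oplus>s\<in>D. \<phi> s \<otimes> r s \<oplus> (if d = s then \<phi> s \<otimes> t else \<zero>))"
      using pc t by (intro finsum_cong') (auto simp: r'_def r_distr)
    also have "\<dots> = ev \<phi> \<oplus> (\<Oplus>s\<in>D. if d = s then \<phi> s \<otimes> t else \<zero>)"
      unfolding ev_def using pc t by (intro finsum_addf) auto
    also have "(\<Oplus>s\<in>D. if d = s then \<phi> s \<otimes> t else \<zero>) = \<phi> d \<otimes> t"
      using add.finprod_singleton[OF d(1) D, of "\<lambda>s. \<phi> s \<otimes> t"] pc t by (auto simp: Pi_def)
    finally have eq: "(\<Oplus>s\<in>D. \<phi> s \<otimes> r' s) = ev \<phi> \<oplus> \<phi> d \<otimes> t" .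
    show ?thesis
    proof (cases "\<phi> d = \<zero>")
      case True
      then have "\<phi> \<in> \<Phi>" using \<phi> d by auto
      then show ?thesis using eq True t evc[OF \<phi>] r(2) by (simp add: ev_def)
    next
      case False
      then have u: "\<phi> d \<in> Units R" using pc[OF d(1)] by (simp add: field_Units)
      show ?thesis
      proof
        assume "(\<Oplus>s\<in>D. \<phi> s \<otimes> r' s) = \<zero>"
        then have "\<phi> d \<otimes> t = \<ominus> ev \<phi>"
          using eq evc[OF \<phi>] pc[OF d(1)] t(1)
          by (intro sum_zero_eq_neg) (auto simp: a_comm)
        then have "t = \<ominus> ev \<phi> \<otimes> inv (\<phi> d)"
          using u t evc[OF \<phi>] pc[OF d(1)]
          by (metis Units_inv_closed Units_l_inv l_one m_assoc m_comm a_inv_closed)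
        then show False using t(2) \<phi> False unfolding bad_def by blast
      qed
    qed
  qed
  then show ?case using r'c by blast
qed

text \<open>The columns are chosen one after the other: \<open>w n\<close> avoids, for every choice of
  earlier times \<open>T\<close> and of prefixes \<open>S\<close> of length \<open>n\<close>, one nontrivial
  linear relation holding at all times in \<open>T\<close>.\<close>

definition relation_at ::
  "('k, 'm) ring_scheme \<Rightarrow> (nat \<Rightarrow> nat set \<Rightarrow> 'k) \<Rightarrow> nat set set \<Rightarrow> (nat set \<Rightarrow> 'k) \<Rightarrow> nat \<Rightarrow> bool" where
  "relation_at K w S a t \<longleftrightarrow> (\<Oplus>\<^bsub>K\<^esub>s\<in>S. a s \<otimes>\<^bsub>K\<^esub> w t (s \<inter> {..<t})) = \<zero>\<^bsub>K\<^esub>"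

definition nontrivial_relation ::
  "('k, 'm) ring_scheme \<Rightarrow> (nat \<Rightarrow> nat set \<Rightarrow> 'k) \<Rightarrow> nat set \<Rightarrow> nat set set \<Rightarrow> (nat set \<Rightarrow> 'k) \<Rightarrow> bool" where
  "nontrivial_relation K w T S a \<longleftrightarrow> a \<in> S \<rightarrow> carrier K \<and> (\<exists>s\<in>S. a s \<noteq> \<zero>\<^bsub>K\<^esub>) \<and> (\<forall>t\<in>T. relation_at K w S a t)"

text \<open>A set of naturals is a branch of the binary tree, \<open>s \<inter> {..<t}\<close> is
  its node at level \<open>t\<close>, and \<open>w t\<close> labels the nodes of that level. For
  each \<open>n\<close> there are only finitely many pairs \<open>(T, S)\<close>; each contributes
  one nonzero linear form on the labels of level \<open>n\<close>, and a suitable labelling avoids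
  the kernels of all of them.\<close>

lemma (in field) ex_generic_columns:
  assumes "infinite (carrier R)"
  shows "\<exists>w. (\<forall>n s. w n s \<in> carrier R) \<and>
    (\<forall>n T S. T \<subseteq> {..<n} \<longrightarrow> S \<subseteq> Pow {..<n} \<longrightarrow> (\<exists>a. nontrivial_relation R w T S a) \<longrightarrow>
       (\<exists>a. nontrivial_relation R w T S a \<and> \<not> relation_at R w S a n))"
proof -
  \<comment> \<open>Times in \<open>T\<close> lie below \<open>n\<close>, so this condition reads
    only the columns chosen before and the candidate \<open>r\<close>, as the well-founded recursion
    requires.\<close>
  define good where "good w n r \<longleftrightarrow> (\<forall>s. r s \<in> carrier R) \<and>
    (\<forall>T S. T \<subseteq> {..<n} \<longrightarrow> S \<subseteq> Pow {..<n} \<longrightarrow> (\<exists>a. nontrivial_relation R w T S a) \<longrightarrow>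
       (\<exists>a. nontrivial_relation R w T S a \<and> (\<Oplus>s\<in>S. a s \<otimes> r s) \<noteq> \<zero>))"
    for w :: "nat \<Rightarrow> nat set \<Rightarrow> 'a" and n r
  have "\<exists>w. \<forall>n. good w n (w n)"
  proof (rule dependent_wf_choice[OF wf_less_than])
    fix w w' :: "nat \<Rightarrow> nat set \<Rightarrow> 'a" and n r
    assume "\<And>m. (m, n) \<in> less_than \<Longrightarrow> w m = w' m"
    then have "nontrivial_relation R w T S = nontrivial_relation R w' T S"
      if "T \<subseteq> {..<n}" for T S
    proof -
      have "w t = w' t" if "t \<in> T" for t
        using \<open>T \<subseteq> {..<n}\<close> that \<open>\<And>m. (m, n) \<in> less_than \<Longrightarrow> w m = w' m\<close> by auto
      then show ?thesis by (auto simp: nontrivial_relation_def relation_at_def fun_eq_iff)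
    qed
    then show "good w n r = good w' n r" unfolding good_def by (simp cong: imp_cong)
  next
    fix n and w :: "nat \<Rightarrow> nat set \<Rightarrow> 'a"
    define Q where "Q = {(T, S). T \<subseteq> {..<n} \<and> S \<subseteq> Pow {..<n} \<and> (\<exists>a. nontrivial_relation R w T S a)}"
    have "finite (Pow {..<n} \<times> Pow (Pow {..<n}))" by simp
    then have "finite Q" unfolding Q_def by (rule rev_finite_subset) auto
    define \<phi> where "\<phi> = (\<lambda>(T, S). SOME a. nontrivial_relation R w T S a)"
    have \<phi>: "nontrivial_relation R w T S (\<phi> (T, S))" if "(T, S) \<in> Q" for T S
      using that someI_ex[of "nontrivial_relation R w T S"] by (simp add: Q_def \<phi>_def)
    \<comment> \<open>Extension by zero turns the relations for the various \<open>S\<close> into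
      forms on one space, with coordinates in \<open>Pow {..<n}\<close>.\<close>
    define ext where "ext = (\<lambda>(T, S) s. if s \<in> S then \<phi> (T, S) s else \<zero>)"
    have "\<psi> \<in> Pow {..<n} \<rightarrow> carrier R \<and> (\<exists>s\<in>Pow {..<n}. \<psi> s \<noteq> \<zero>)" if \<psi>: "\<psi> \<in> ext ` Q" for \<psi>
    proof -
      from \<psi> obtain T S where TS: "(T, S) \<in> Q" "\<psi> = ext (T, S)" by auto
      have S: "S \<subseteq> Pow {..<n}" using TS(1) by (simp add: Q_def)
      have p: "\<phi> (T, S) \<in> S \<rightarrow> carrier R" "\<exists>s\<in>S. \<phi> (T, S) s \<noteq> \<zero>"
        using \<phi>[OF TS(1)] by (simp_all add: nontrivial_relation_def)
      have "\<psi> \<in> Pow {..<n} \<rightarrow> carrier R" using p(1) by (simp add: TS(2) ext_def Pi_iff)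
      moreover from p(2) obtain s where "s \<in> S" "\<phi> (T, S) s \<noteq> \<zero>" ..
      then have "s \<in> Pow {..<n}" "\<psi> s \<noteq> \<zero>" using S by (auto simp: TS(2) ext_def)
      ultimately show ?thesis by blast
    qed
    then obtain r where r: "r \<in> Pow {..<n} \<rightarrow> carrier R" "\<forall>\<psi>\<in>ext ` Q. (\<Oplus>s\<in>Pow {..<n}. \<psi> s \<otimes> r s) \<noteq> \<zero>"
      using ex_avoiding_linear_forms[OF assms, of "Pow {..<n}" "ext ` Q"] \<open>finite Q\<close> by auto
    define r' where "r' s = (if s \<in> Pow {..<n} then r s else \<zero>)" for s
    have "(\<Oplus>s\<in>S. \<phi> (T, S) s \<otimes> r' s) \<noteq> \<zero>" if TS: "(T, S) \<in> Q" for T S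
    proof -
      have S: "S \<subseteq> Pow {..<n}" and p: "\<phi> (T, S) \<in> S \<rightarrow> carrier R"
        using TS \<phi>[OF TS] by (auto simp: Q_def nontrivial_relation_def)
      have "(\<Oplus>s\<in>S. \<phi> (T, S) s \<otimes> r' s) = (\<Oplus>s\<in>Pow {..<n}. ext (T, S) s \<otimes> r s)"
        using S p r(1)
        by (intro add.finprod_mono_neutral_cong_left) (auto simp: ext_def r'_def Pi_iff subset_iff)
      then show ?thesis using r(2) TS by auto
    qed
    moreover have "r' s \<in> carrier R" for s using r(1) by (auto simp: r'_def)
    moreover have "(T, S) \<in> Q" if "T \<subseteq> {..<n}" "S \<subseteq> Pow {..<n}" "\<exists>a. nontrivial_relation R w T S a" for T S
      using that by (simp add: Q_def)
    ultimately have "good w n r'" unfolding good_def using \<phi> by metis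
    then show "\<exists>r. good w n r" by (intro exI[of _ r'])
  qed
  then obtain w where w: "\<And>n. good w n (w n)" by blast
  have eq: "relation_at R w S a n \<longleftrightarrow> (\<Oplus>s\<in>S. a s \<otimes> w n s) = \<zero>"
    if "S \<subseteq> Pow {..<n}" "a \<in> S \<rightarrow> carrier R" for S a n
  proof -
    have "(\<Oplus>s\<in>S. a s \<otimes> w n (s \<inter> {..<n})) = (\<Oplus>s\<in>S. a s \<otimes> w n s)"
      using that w unfolding good_def
      by (intro finsum_cong') (auto simp: Int_absorb2 Pi_iff subset_iff)
    then show ?thesis by (simp add: relation_at_def)
  qed
  show ?thesis
  proof (intro exI[of _ w] conjI allI impI)
    show "w n s \<in> carrier R" for n s using w by (simp add: good_def)
    fix n T S
    assume TS: "T \<subseteq> {..<n}" "S \<subseteq> Pow {..<n}" "\<exists>a. nontrivial_relation R w T S a"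
    then obtain a where a: "nontrivial_relation R w T S a" "(\<Oplus>s\<in>S. a s \<otimes> w n s) \<noteq> \<zero>"
      using w[of n] unfolding good_def by blast
    then have "\<not> relation_at R w S a n" using eq[OF TS(2)] by (auto simp: nontrivial_relation_def)
    then show "\<exists>a. nontrivial_relation R w T S a \<and> \<not> relation_at R w S a n" using a(1) by blast
  qed
qed

text \<open>By induction the relations holding at all times in \<open>T\<close> but the last are multiples of a single one,
  and the last column avoids that one.\<close>

lemma (in field) generic_columns_relation_trivial:
  assumes w: "\<And>n s. w n s \<in> carrier R"
    and gen: "\<And>n T S a. T \<subseteq> {..<n} \<Longrightarrow> S \<subseteq> Pow {..<n} \<Longrightarrow> nontrivial_relation R w T S a \<Longrightarrow>
       \<exists>a. nontrivial_relation R w T S a \<and> \<not> relation_at R w S a n"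
    and "finite S" "inj_on (\<lambda>s. s \<inter> {..<N}) S" "finite T" "T \<subseteq> {N..}" "card T = card S"
    and "a \<in> S \<rightarrow> carrier R" "\<And>t. t \<in> T \<Longrightarrow> relation_at R w S a t"
  shows "\<forall>s\<in>S. a s = \<zero>"
  using assms(3-)
proof (induction "card S" arbitrary: S T a)
  case 0 then show ?case by simp
next
  case (Suc m)
  define n where "n = Max T"
  have Tne: "T \<noteq> {}" using Suc.hyps(2) Suc.prems(5) by auto
  have nT: "n \<in> T" unfolding n_def using Tne Suc.prems(3) by simp
  have Nn: "N \<le> n" using nT Suc.prems(4) by auto
  define T' where "T' = T - {n}"
  have T': "T' \<subseteq> {..<n}" using Suc.prems(3) unfolding T'_def n_def
    by (auto simp: less_le)
  have cT': "card T' = m" using nT Suc.hyps(2) Suc.prems(3,5) by (simp add: T'_def)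
  show ?case
  proof (rule ccontr)
    assume nz: "\<not> (\<forall>s\<in>S. a s = \<zero>)"
    \<comment> \<open>\<open>gen\<close> concerns prefixes of length \<open>n\<close>, whereas
      \<open>S\<close> consists of whole branches. Truncation at \<open>n\<close> stays injective on
      \<open>S\<close> because \<open>N \<le> n\<close>, and it does not affect relations at times
      up to \<open>n\<close>.\<close>
    define pr where "pr s = s \<inter> {..<n}" for s :: "nat set"
    have inj: "inj_on pr S"
    proof (rule inj_onI)
      fix s s' assume s: "s \<in> S" "s' \<in> S" "pr s = pr s'"
      have "pr x \<inter> {..<N} = x \<inter> {..<N}" for x using Nn by (auto simp: pr_def)
      then have "s \<inter> {..<N} = s' \<inter> {..<N}" using s(3) by metis
      then show "s = s'" using inj_onD[OF Suc.prems(2) _ s(1,2)] by simp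
    qed
    have pr_rel: "relation_at R w (pr ` S) b t \<longleftrightarrow> relation_at R w S (b \<circ> pr) t"
      if "b \<in> pr ` S \<rightarrow> carrier R" "t \<le> n" for b t
    proof -
      have "pr s \<inter> {..<t} = s \<inter> {..<t}" for s using that by (auto simp: pr_def)
      moreover have "(\<Oplus>s\<in>pr ` S. b s \<otimes> w t (s \<inter> {..<t})) = (\<Oplus>s\<in>S. b (pr s) \<otimes> w t (pr s \<inter> {..<t}))"
        using that w inj by (intro finsum_reindex) (auto simp: Pi_iff)
      ultimately show ?thesis by (simp add: relation_at_def)
    qed
    have ac: "a s \<in> carrier R" if "s \<in> S" for s using Suc.prems(6) that by auto
    define a' where "a' = a \<circ> the_inv_into S pr"
    have a'pr: "a' (pr s) = a s" if "s \<in> S" for s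
      using inj that by (simp add: a'_def the_inv_into_f_f)
    have a'c: "a' \<in> pr ` S \<rightarrow> carrier R" using a'pr ac by auto
    have cong: "relation_at R w S (a' \<circ> pr) t \<longleftrightarrow> relation_at R w S a t" for t
    proof -
      have "(\<Oplus>s\<in>S. a' (pr s) \<otimes> w t (s \<inter> {..<t})) = (\<Oplus>s\<in>S. a s \<otimes> w t (s \<inter> {..<t}))"
        using a'pr ac w by (intro finsum_cong') auto
      then show ?thesis by (simp add: relation_at_def)
    qed
    have "nontrivial_relation R w T' (pr ` S) a'"
      unfolding nontrivial_relation_def
    proof (intro conjI ballI)
      show "a' \<in> pr ` S \<rightarrow> carrier R" by (rule a'c)
      show "\<exists>s\<in>pr ` S. a' s \<noteq> \<zero>" using nz a'pr by auto
      show "relation_at R w (pr ` S) a' t" if "t \<in> T'" for t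
      proof -
        have "t \<le> n" using T' that by auto
        then show ?thesis using pr_rel[OF a'c] cong Suc.prems(7)[of t] that by (simp add: T'_def)
      qed
    qed
    moreover have "pr ` S \<subseteq> Pow {..<n}" by (auto simp: pr_def)
    ultimately obtain b' where b': "nontrivial_relation R w T' (pr ` S) b'"
      "\<not> relation_at R w (pr ` S) b' n" using gen[OF T'] by blast
    have b'c: "b' \<in> pr ` S \<rightarrow> carrier R" using b'(1) by (simp add: nontrivial_relation_def)
    define b where "b = b' \<circ> pr"
    have bc: "b s \<in> carrier R" if "s \<in> S" for s using b'c that by (auto simp: b_def)
    have b_rel: "relation_at R w S b t" if "t \<in> T'" for t
    proof -
      have "t \<le> n" using T' that by auto
      moreover have "relation_at R w (pr ` S) b' t" using b'(1) that by (simp add: nontrivial_relation_def)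
      ultimately show ?thesis using pr_rel[OF b'c] by (simp add: b_def)
    qed
    have b_n: "\<not> relation_at R w S b n" using b'(2) pr_rel[OF b'c, of n] by (simp add: b_def)
    obtain j where j: "j \<in> S" "b j \<noteq> \<zero>" using b'(1) by (auto simp: nontrivial_relation_def b_def)
    \<comment> \<open>\<open>d\<close> eliminates the branch \<open>j\<close> and inherits from
      \<open>a\<close> and \<open>b\<close> the relations at all times in \<open>T'\<close>. One
      branch and one time fewer remain, so the induction hypothesis makes \<open>d\<close> vanish:
      \<open>a\<close> and \<open>b\<close> are proportional.\<close>
    define d where "d s = a j \<otimes> b s \<oplus> \<ominus> b j \<otimes> a s" for s
    have dc: "d s \<in> carrier R" if "s \<in> S" for s using that ac bc j(1) by (simp add: d_def)
    have d_sum: "(\<Oplus>s\<in>S. d s \<otimes> w t (s \<inter> {..<t})) =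
        a j \<otimes> (\<Oplus>s\<in>S. b s \<otimes> w t (s \<inter> {..<t})) \<oplus> \<ominus> b j \<otimes> (\<Oplus>s\<in>S. a s \<otimes> w t (s \<inter> {..<t}))" for t
    proof -
      have "(\<Oplus>s\<in>S. d s \<otimes> w t (s \<inter> {..<t})) =
          (\<Oplus>s\<in>S. a j \<otimes> (b s \<otimes> w t (s \<inter> {..<t})) \<oplus> \<ominus> b j \<otimes> (a s \<otimes> w t (s \<inter> {..<t})))"
        using ac bc j(1) w by (intro finsum_cong') (auto simp: d_def l_distr m_assoc)
      also have "\<dots> = (\<Oplus>s\<in>S. a j \<otimes> (b s \<otimes> w t (s \<inter> {..<t}))) \<oplus>
          (\<Oplus>s\<in>S. \<ominus> b j \<otimes> (a s \<otimes> w t (s \<inter> {..<t})))"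
        using ac bc j(1) w by (intro finsum_addf) auto
      also have "(\<Oplus>s\<in>S. a j \<otimes> (b s \<otimes> w t (s \<inter> {..<t}))) = a j \<otimes> (\<Oplus>s\<in>S. b s \<otimes> w t (s \<inter> {..<t}))"
        using ac bc j(1) w Suc.prems(1) by (intro finsum_rdistr[symmetric]) auto
      also have "(\<Oplus>s\<in>S. \<ominus> b j \<otimes> (a s \<otimes> w t (s \<inter> {..<t}))) = \<ominus> b j \<otimes> (\<Oplus>s\<in>S. a s \<otimes> w t (s \<inter> {..<t}))"
        using ac bc j(1) w Suc.prems(1) by (intro finsum_rdistr[symmetric]) auto
      finally show ?thesis .
    qed
    have dj: "d j = \<zero>" using ac[OF j(1)] bc[OF j(1)] m_comm[of "a j" "b j"]
      by (simp add: d_def l_minus r_neg)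
    have d0: "d s = \<zero>" if s: "s \<in> S" for s
    proof (cases "s = j")
      case True then show ?thesis using dj by simp
    next
      case False
      have "\<forall>s\<in>S - {j}. d s = \<zero>"
      proof (rule Suc.hyps(1))
        show "m = card (S - {j})" using Suc.hyps(2) j(1) Suc.prems(1) by simp
        show "card T' = card (S - {j})" using Suc.hyps(2) j(1) Suc.prems(1) cT' by simp
        show "inj_on (\<lambda>s. s \<inter> {..<N}) (S - {j})" using Suc.prems(2) by (auto intro: inj_on_diff)
        show "finite (S - {j})" "finite T'" "T' \<subseteq> {N..}" "d \<in> S - {j} \<rightarrow> carrier R"
          using Suc.prems dc by (auto simp: T'_def)
        fix t assume t: "t \<in> T'"
        then have "relation_at R w S b t" "relation_at R w S a t"
          using b_rel Suc.prems(7) by (auto simp: T'_def)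
        then have "(\<Oplus>s\<in>S. d s \<otimes> w t (s \<inter> {..<t})) = \<zero>"
          using d_sum[of t] ac[OF j(1)] bc[OF j(1)] by (simp add: relation_at_def)
        moreover have "(\<Oplus>s\<in>S - {j}. d s \<otimes> w t (s \<inter> {..<t})) = (\<Oplus>s\<in>S. d s \<otimes> w t (s \<inter> {..<t}))"
          using Suc.prems(1) dj dc w by (intro add.finprod_mono_neutral_cong_left) auto
        ultimately show "relation_at R w (S - {j}) d t" by (simp add: relation_at_def)
      qed
      then show ?thesis using s False by simp
    qed
    \<comment> \<open>At time \<open>n\<close> the relation \<open>a\<close> holds while
      \<open>b\<close> does not, so the vanishing of \<open>d\<close> forces
      \<open>a j = \<zero>\<close>. As \<open>b j\<close> is nonzero, all of \<open>a\<close> then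
      vanishes.\<close>
    have "(\<Oplus>s\<in>S. d s \<otimes> w n (s \<inter> {..<n})) = \<zero>" using d0 w by (intro add.finprod_one_eqI) simp
    moreover have "(\<Oplus>s\<in>S. a s \<otimes> w n (s \<inter> {..<n})) = \<zero>"
      using Suc.prems(7)[OF nT] by (simp add: relation_at_def)
    moreover have bsum: "(\<Oplus>s\<in>S. b s \<otimes> w n (s \<inter> {..<n})) \<in> carrier R"
      using bc w by (intro finsum_closed) auto
    ultimately have "a j \<otimes> (\<Oplus>s\<in>S. b s \<otimes> w n (s \<inter> {..<n})) = \<zero>"
      using d_sum[of n] ac[OF j(1)] bc[OF j(1)] by simp
    then have "a j = \<zero>" using b_n bsum ac[OF j(1)] by (auto simp: relation_at_def integral_iff)
    then have "\<ominus> b j \<otimes> a s = \<zero>" if "s \<in> S" for s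
      using d0[OF that] ac[OF that] bc[OF that] bc[OF j(1)] by (simp add: d_def)
    then have "a s = \<zero>" if "s \<in> S" for s
      using that j bc[OF j(1)] ac[OF that] by (metis a_inv_closed integral_iff minus_minus minus_zero)
    then show False using nz by blast
  qed
qed

text \<open>Two distinct sets differ at some number; as \<open>S\<close> is finite, one bound
  \<open>N\<close> lies above such a number for every pair.\<close>

lemma ex_separating_prefix:
  fixes S :: "nat set set"
  assumes "finite S"
  shows "\<exists>N. inj_on (\<lambda>s. s \<inter> {..<N}) S"
proof -
  define p where "p = (\<lambda>(s, s' :: nat set). SOME k. k \<in> s \<longleftrightarrow> k \<notin> s')"
  have p: "p (s, s') \<in> s \<longleftrightarrow> p (s, s') \<notin> s'" if "s \<noteq> s'" for s s'
  proof -
    have "\<exists>k. k \<in> s \<longleftrightarrow> k \<notin> s'" using that by blast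
    from someI_ex[OF this] show ?thesis unfolding p_def by simp
  qed
  have "finite (p ` (S \<times> S))" using assms by simp
  then obtain N where N: "\<And>q. q \<in> p ` (S \<times> S) \<Longrightarrow> q < N"
    by (auto simp: finite_nat_set_iff_bounded)
  have "inj_on (\<lambda>s. s \<inter> {..<N}) S"
  proof (rule inj_onI, rule ccontr)
    fix s s' assume s: "s \<in> S" "s' \<in> S" "s \<inter> {..<N} = s' \<inter> {..<N}" "s \<noteq> s'"
    then have "p (s, s') < N" using N by blast
    then show False using p[OF s(4)] s(3) by blast
  qed
  then show ?thesis ..
qed

text \<open>The function belonging to a branch \<open>s\<close> has at index \<open>i\<close> the
  label of its node at level \<open>e i\<close>. A finite \<open>S\<close> is separated below some
  level \<open>N\<close>; an infinite zero set would provide \<open>card S\<close> levels from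
  \<open>N\<close> on at which one relation holds, and genericity makes such a relation
  trivial.\<close>

lemma (in field) ex_cofinitely_independent_continuum:
  fixes e :: "'i \<Rightarrow> nat"
  assumes inf: "infinite (carrier R)" and e: "inj_on e I"
  shows "\<exists>v. cofinitely_independent R (UNIV :: nat set set) I v"
proof -
  obtain w where w: "\<And>n s. w n s \<in> carrier R"
    and gen: "\<And>n T S a. T \<subseteq> {..<n} \<Longrightarrow> S \<subseteq> Pow {..<n} \<Longrightarrow> nontrivial_relation R w T S a \<Longrightarrow>
       \<exists>a. nontrivial_relation R w T S a \<and> \<not> relation_at R w S a n"
    using ex_generic_columns[OF inf] by metis
  define v where "v s i = w (e i) (s \<inter> {..<e i})" for s i
  have "finite {i\<in>I. (\<Oplus>s\<in>S. a s \<otimes> v s i) = \<zero>}" (is "finite ?Z")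
    if S: "finite S" "a \<in> S \<rightarrow> carrier R" and nz: "\<exists>s\<in>S. a s \<noteq> \<zero>" for S a
  proof (rule ccontr)
    assume "infinite ?Z"
    then have infZ: "infinite (e ` ?Z)" using e by (simp add: finite_image_iff inj_on_def)
    obtain N where N: "inj_on (\<lambda>s. s \<inter> {..<N}) S" using ex_separating_prefix[OF S(1)] ..
    have "infinite (e ` ?Z - {..<N})" using infZ by simp
    then obtain T where T: "T \<subseteq> e ` ?Z - {..<N}" "finite T" "card T = card S"
      using infinite_arbitrarily_large by blast
    have "\<forall>s\<in>S. a s = \<zero>"
    proof (rule generic_columns_relation_trivial[OF w gen S(1) N T(2) _ T(3) S(2)])
      show "T \<subseteq> {N..}" using T(1) by (auto simp: not_less)
      show "relation_at R w S a t" if "t \<in> T" for t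
        using T(1) that by (auto simp: relation_at_def v_def)
    qed
    then show False using nz by blast
  qed
  then have "cofinitely_independent R UNIV I v"
    unfolding cofinitely_independent_def using w by (auto simp: v_def)
  then show ?thesis by (intro exI[of _ v])
qed

section \<open>Linear relations beyond the rank\<close>

text \<open>Gaussian elimination without division, by induction on the equations. A nonzero pivot
  \<open>c x0 e0\<close> is cross-multiplied instead of inverted, and solutions stay nontrivial
  because there are no zero divisors.\<close>

lemma (in domain) ex_nontrivial_solution:
  assumes "finite E" "finite F" "card E < card F"
    and "\<And>x e. x \<in> F \<Longrightarrow> e \<in> E \<Longrightarrow> c x e \<in> carrier R"
  shows "\<exists>d. d \<in> F \<rightarrow> carrier R \<and> (\<exists>x\<in>F. d x \<noteq> \<zero>) \<and> (\<forall>e\<in>E. (\<Oplus>x\<in>F. d x \<otimes> c x e) = \<zero>)"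
  using assms
proof (induction E arbitrary: F c)
  case empty
  then obtain x where "x \<in> F" by fastforce
  then show ?case by (intro exI[of _ "\<lambda>_. \<one>"]) auto
next
  case (insert e0 E)
  have cc [simp]: "c x e \<in> carrier R" if "x \<in> F" "e \<in> insert e0 E" for x e
    using insert.prems(3) that by blast
  show ?case
  proof (cases "\<forall>x\<in>F. c x e0 = \<zero>")
    case True
    have "card E < card F" using insert.hyps insert.prems(2) by simp
    then obtain d where d: "d \<in> F \<rightarrow> carrier R" "\<exists>x\<in>F. d x \<noteq> \<zero>" "\<forall>e\<in>E. (\<Oplus>x\<in>F. d x \<otimes> c x e) = \<zero>"
      using insert.IH[of F c] insert.prems by auto
    have "(\<Oplus>x\<in>F. d x \<otimes> c x e0) = \<zero>" using True d(1) by (intro add.finprod_one_eqI) (auto dest: funcset_mem)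
    then show ?thesis using d by (intro exI[of _ d]) auto
  next
    case False
    then obtain x0 where x0: "x0 \<in> F" "c x0 e0 \<noteq> \<zero>" by auto
    define F' where "F' = F - {x0}"
    have F': "finite F'" "x0 \<notin> F'" "F = insert x0 F'" "\<And>x. x \<in> F' \<Longrightarrow> x \<in> F"
      using insert.prems(1) x0 by (auto simp: F'_def)
    \<comment> \<open>The 2 by 2 minors at the pivot: the coefficients left after the equation
      \<open>e0\<close> has been used to eliminate the unknown \<open>x0\<close>.\<close>
    define c' where "c' x e = c x0 e0 \<otimes> c x e \<ominus> c x e0 \<otimes> c x0 e" for x e
    have c'c: "c' x e \<in> carrier R" if "x \<in> F'" "e \<in> E" for x e
      using that F'(4) x0(1) by (simp add: c'_def)
    have "card E < card F'" using insert.prems(1,2) insert.hyps x0 by (simp add: F'_def)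
    then obtain d where d: "d \<in> F' \<rightarrow> carrier R" "\<exists>x\<in>F'. d x \<noteq> \<zero>" "\<forall>e\<in>E. (\<Oplus>x\<in>F'. d x \<otimes> c' x e) = \<zero>"
      using insert.IH[of F' c'] F'(1) c'c by auto
    have dc [simp]: "d x \<in> carrier R" if "x \<in> F'" for x using d(1) that by auto
    \<comment> \<open>Back substitution: the other unknowns are multiplied by the pivot, so that the
      equation \<open>e0\<close> can be solved for \<open>x0\<close> without dividing.\<close>
    define D where "D x = (if x = x0 then \<ominus> (\<Oplus>x\<in>F'. d x \<otimes> c x e0) else d x \<otimes> c x0 e0)" for x
    have sc [simp]: "(\<Oplus>x\<in>F'. d x \<otimes> c x e) \<in> carrier R" if "e \<in> insert e0 E" for e
      using that F'(4) by (intro finsum_closed) auto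
    have Dc: "D x \<in> carrier R" if "x \<in> F" for x
      using that x0 F'(3) by (auto simp: D_def)
    have sumD: "(\<Oplus>x\<in>F. D x \<otimes> c x e) =
        \<ominus> (\<Oplus>x\<in>F'. d x \<otimes> c x e0) \<otimes> c x0 e \<oplus> c x0 e0 \<otimes> (\<Oplus>x\<in>F'. d x \<otimes> c x e)"
      if e: "e \<in> insert e0 E" for e
    proof -
      have "(\<Oplus>x\<in>F. D x \<otimes> c x e) = D x0 \<otimes> c x0 e \<oplus> (\<Oplus>x\<in>F'. D x \<otimes> c x e)"
        unfolding F'(3) using F' Dc e by (intro finsum_insert) auto
      also have "(\<Oplus>x\<in>F'. D x \<otimes> c x e) = (\<Oplus>x\<in>F'. c x0 e0 \<otimes> (d x \<otimes> c x e))"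
        using F' e x0 by (intro finsum_cong') (auto simp: D_def m_ac)
      also have "\<dots> = c x0 e0 \<otimes> (\<Oplus>x\<in>F'. d x \<otimes> c x e)"
        using F' e x0 by (intro finsum_rdistr[symmetric]) auto
      finally show ?thesis by (simp add: D_def)
    qed
    have "(\<Oplus>x\<in>F. D x \<otimes> c x e) = \<zero>" if e: "e \<in> insert e0 E" for e
    proof (cases "e = e0")
      case True
      then show ?thesis using sumD[OF e] x0(1) m_comm[of "c x0 e0" "\<Oplus>x\<in>F'. d x \<otimes> c x e0"]
        by (simp add: l_minus l_neg)
    next
      case False
      then have eE: "e \<in> E" using e by simp
      have "\<zero> = (\<Oplus>x\<in>F'. d x \<otimes> c' x e)" using d(3) eE by simp
      also have "\<dots> = (\<Oplus>x\<in>F'. (\<ominus> c x0 e) \<otimes> (d x \<otimes> c x e0) \<oplus> c x0 e0 \<otimes> (d x \<otimes> c x e))"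
      proof (intro finsum_cong')
        fix x assume x: "x \<in> F'"
        have m: "c x0 e0 \<in> carrier R" "c x e \<in> carrier R" "c x e0 \<in> carrier R" "c x0 e \<in> carrier R"
          "d x \<in> carrier R" using x x0 F'(4) e by auto
        then show "d x \<otimes> c' x e = (\<ominus> c x0 e) \<otimes> (d x \<otimes> c x e0) \<oplus> c x0 e0 \<otimes> (d x \<otimes> c x e)"
          unfolding c'_def a_minus_def by algebra
      qed (use F' e x0 in auto)
      also have "\<dots> = (\<Oplus>x\<in>F'. (\<ominus> c x0 e) \<otimes> (d x \<otimes> c x e0)) \<oplus> (\<Oplus>x\<in>F'. c x0 e0 \<otimes> (d x \<otimes> c x e))"
        using F' e x0 by (intro finsum_addf) auto
      also have "(\<Oplus>x\<in>F'. (\<ominus> c x0 e) \<otimes> (d x \<otimes> c x e0)) = (\<ominus> c x0 e) \<otimes> (\<Oplus>x\<in>F'. d x \<otimes> c x e0)"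
        using F' e x0 by (intro finsum_rdistr[symmetric]) auto
      also have "(\<Oplus>x\<in>F'. c x0 e0 \<otimes> (d x \<otimes> c x e)) = c x0 e0 \<otimes> (\<Oplus>x\<in>F'. d x \<otimes> c x e)"
        using F' e x0 by (intro finsum_rdistr[symmetric]) auto
      finally show ?thesis using sumD[OF e] x0(1) e
        by (simp add: l_minus m_comm[of "c x0 e"])
    qed
    moreover obtain x1 where "x1 \<in> F'" "d x1 \<noteq> \<zero>" using d(2) by auto
    then have "D x1 \<noteq> \<zero>" "x1 \<in> F" using x0 F' by (auto simp: D_def integral_iff)
    ultimately show ?thesis using Dc by (intro exI[of _ D]) auto
  qed
qed

section \<open>Relations between more elements than the rank\<close>

text \<open>An infinite \<open>S\<close> has only \<open>|S|\<close> finite subsets, so finite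
  fibres would cover at most \<open>|S|\<close> elements of \<open>Y\<close>. For finite
  \<open>S\<close> there are finitely many fibres, and the pigeonhole principle applies.\<close>

lemma ex_infinite_fiber_Fpow:
  assumes Y: "infinite Y" and S: "|S| <o |Y|" and h: "\<And>x. x \<in> Y \<Longrightarrow> h x \<in> Fpow S"
  shows "\<exists>E\<in>Fpow S. infinite {x\<in>Y. h x = E}"
proof (cases "finite S")
  case True
  then have "finite (h ` Y)"
    using h by (intro finite_subset[of "h ` Y" "Pow S"]) (auto simp: Fpow_def)
  then obtain x where "x \<in> Y" "infinite {x'\<in>Y. h x' = h x}"
    using pigeonhole_infinite[OF Y] by auto
  then show ?thesis using h by blast
next
  case False
  show ?thesis
  proof (rule ccontr)
    assume "\<not> ?thesis"
    then have fib: "finite {x\<in>Y. h x = E}" if "E \<in> Fpow S" for E using that by blast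
    have "|\<Union>E\<in>Fpow S. {x\<in>Y. h x = E}| \<le>o |S|"
    proof (rule card_of_UNION_ordLeq_infinite[OF False])
      show "|Fpow S| \<le>o |S|" using card_of_Fpow_infinite[OF False] by (rule ordIso_imp_ordLeq)
      show "\<forall>E\<in>Fpow S. |{x\<in>Y. h x = E}| \<le>o |S|"
        using fib False by (intro ballI ordLess_imp_ordLeq finite_ordLess_infinite2) auto
    qed
    moreover have "(\<Union>E\<in>Fpow S. {x\<in>Y. h x = E}) = Y" using h by auto
    ultimately show False using S not_ordLess_ordLeq by fastforce
  qed
qed

lemma (in abelian_monoid) finsum_swap:
  assumes "finite F" "finite E" "\<And>x e. x \<in> F \<Longrightarrow> e \<in> E \<Longrightarrow> g x e \<in> carrier G"
  shows "(\<Oplus>x\<in>F. \<Oplus>e\<in>E. g x e) = (\<Oplus>e\<in>E. \<Oplus>x\<in>F. g x e)"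
  using assms(1,3)
proof (induction F)
  case empty then show ?case by (simp add: add.finprod_one_eqI)
next
  case (insert x F)
  have "(\<Oplus>x'\<in>insert x F. \<Oplus>e\<in>E. g x' e) = (\<Oplus>e\<in>E. g x e) \<oplus> (\<Oplus>x'\<in>F. \<Oplus>e\<in>E. g x' e)"
    using insert by (intro finsum_insert) auto
  also have "\<dots> = (\<Oplus>e\<in>E. g x e) \<oplus> (\<Oplus>e\<in>E. \<Oplus>x'\<in>F. g x' e)" using insert by simp
  also have "\<dots> = (\<Oplus>e\<in>E. g x e \<oplus> (\<Oplus>x'\<in>F. g x' e))"
    using insert.prems by (intro finsum_addf[symmetric]) auto
  also have "\<dots> = (\<Oplus>e\<in>E. \<Oplus>x'\<in>insert x F. g x' e)"
    using insert by (intro finsum_cong') (auto simp: Pi_iff intro!: finsum_insert[symmetric] finsum_closed)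
  finally show ?case .
qed

lemma (in module) finsum_smult_rdistr:
  assumes "finite F" "a \<in> F \<rightarrow> carrier R" "m \<in> carrier M"
  shows "(\<Oplus>x\<in>F. a x) \<odot>\<^bsub>M\<^esub> m = (\<Oplus>\<^bsub>M\<^esub>x\<in>F. a x \<odot>\<^bsub>M\<^esub> m)"
  using assms
proof (induction F)
  case empty then show ?case by simp
next
  case (insert x F)
  then have "a x \<in> carrier R" "a \<in> F \<rightarrow> carrier R" by auto
  then show ?case using insert by (simp add: Pi_iff smult_l_distr)
qed

text \<open>Adding a new \<open>y\<close> to \<open>S\<close> creates a relation by maximality, and
  independence of \<open>S\<close> makes the coefficient of \<open>y\<close> in it nonzero. This
  coefficient need not be invertible, so only a multiple of \<open>y\<close> is expressed through
  \<open>S\<close>.\<close>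

lemma max_lin_indep_multiple_in_span:
  fixes R (structure) and M :: "('r, 'b) module"
  assumes "module R M" "\<one> \<noteq> \<zero>" and S: "max_lin_indep R M S" and y: "y \<in> carrier M"
  shows "\<exists>r E c. r \<in> carrier R \<and> r \<noteq> \<zero> \<and> E \<in> Fpow S \<and> c \<in> E \<rightarrow> carrier R \<and>
    r \<odot>\<^bsub>M\<^esub> y = (\<Oplus>\<^bsub>M\<^esub>e\<in>E. c e \<odot>\<^bsub>M\<^esub> e)"
proof -
  interpret module R M by (rule assms(1))
  show ?thesis
  proof (cases "y \<in> S")
    case True
    then show ?thesis using assms(2) y
      by (intro exI[of _ \<one>] exI[of _ "{y}"] exI[of _ "\<lambda>_. \<one>"]) (auto simp: Fpow_def)
  next
    case False
    have indep: "lin_indep R M S" using S by (simp add: max_lin_indep_def)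
    then have Sc: "S \<subseteq> carrier M" by (simp add: lin_indep_def)
    have "\<not> lin_indep R M (insert y S)" using S False by (auto simp: max_lin_indep_def)
    then obtain F c where F: "finite F" "F \<subseteq> insert y S" "c \<in> F \<rightarrow> carrier R"
      "(\<Oplus>\<^bsub>M\<^esub>x\<in>F. c x \<odot>\<^bsub>M\<^esub> x) = \<zero>\<^bsub>M\<^esub>" "\<exists>x\<in>F. c x \<noteq> \<zero>"
      using Sc y unfolding lin_indep_def by auto
    define E where "E = F - {y}"
    have E: "finite E" "E \<subseteq> S" "y \<notin> E" "c \<in> E \<rightarrow> carrier R" using F by (auto simp: E_def)
    have Ec: "x \<in> carrier M" "c x \<in> carrier R" if "x \<in> E" for x using that E Sc by auto
    have indepE: "\<forall>x\<in>E. c x = \<zero>" if "(\<Oplus>\<^bsub>M\<^esub>x\<in>E. c x \<odot>\<^bsub>M\<^esub> x) = \<zero>\<^bsub>M\<^esub>"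
      using indep E that unfolding lin_indep_def by blast
    have yF: "y \<in> F"
    proof (rule ccontr)
      assume "y \<notin> F"
      then have "F = E" by (auto simp: E_def)
      then show False using indepE F by auto
    qed
    then have FE: "F = insert y E" and cy: "c y \<in> carrier R" using F(3) by (auto simp: E_def)
    have sumE: "(\<Oplus>\<^bsub>M\<^esub>x\<in>E. c x \<odot>\<^bsub>M\<^esub> x) \<in> carrier M" using Ec by (intro M.finsum_closed) auto
    have "(\<Oplus>\<^bsub>M\<^esub>x\<in>F. c x \<odot>\<^bsub>M\<^esub> x) = c y \<odot>\<^bsub>M\<^esub> y \<oplus>\<^bsub>M\<^esub> (\<Oplus>\<^bsub>M\<^esub>x\<in>E. c x \<odot>\<^bsub>M\<^esub> x)"
      unfolding FE using E Ec cy y by (intro M.finsum_insert) auto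
    then have eq: "c y \<odot>\<^bsub>M\<^esub> y \<oplus>\<^bsub>M\<^esub> (\<Oplus>\<^bsub>M\<^esub>x\<in>E. c x \<odot>\<^bsub>M\<^esub> x) = \<zero>\<^bsub>M\<^esub>" using F(4) by simp
    have cy0: "c y \<noteq> \<zero>"
    proof
      assume "c y = \<zero>"
      then have "\<forall>x\<in>E. c x = \<zero>" using indepE eq y sumE by simp
      then show False using F(5) FE \<open>c y = \<zero>\<close> by auto
    qed
    have "(\<ominus> c y) \<odot>\<^bsub>M\<^esub> y = (\<Oplus>\<^bsub>M\<^esub>x\<in>E. c x \<odot>\<^bsub>M\<^esub> x)"
      using eq cy y sumE by (simp add: smult_l_minus M.minus_equality M.a_comm)
    moreover have "\<ominus> c y \<noteq> \<zero>" using cy cy0 by (metis R.minus_minus R.minus_zero)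
    ultimately show ?thesis using E cy
      by (intro exI[of _ "\<ominus> c y"] exI[of _ E] exI[of _ c]) (auto simp: Fpow_def)
  qed
qed

text \<open>Each \<open>y x\<close> has a multiple by a nonzero scalar in the span of a finite
  subset of \<open>S\<close>. As \<open>Y\<close> is larger than \<open>S\<close>, infinitely many
  \<open>x\<close> share one subset \<open>E0\<close>, and more than \<open>card E0\<close> vectors
  in its span are dependent.\<close>

lemma ex_linear_relation:
  fixes R (structure) and M :: "('r, 'b) module"
  assumes M: "module R M" and R: "domain R" and S: "max_lin_indep R M S" and Y: "infinite Y" "|S| <o |Y|"
    and y: "\<And>x. x \<in> Y \<Longrightarrow> y x \<in> carrier M"
  shows "\<exists>F d. finite F \<and> F \<subseteq> Y \<and> d \<in> F \<rightarrow> carrier R \<and> (\<exists>x\<in>F. d x \<noteq> \<zero>) \<and>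
    (\<Oplus>\<^bsub>M\<^esub>x\<in>F. d x \<odot>\<^bsub>M\<^esub> y x) = \<zero>\<^bsub>M\<^esub>"
proof -
  interpret R: domain R by (rule R)
  interpret module R M by (rule M)
  have ex: "\<exists>r E c. r \<in> carrier R \<and> r \<noteq> \<zero> \<and> E \<in> Fpow S \<and> c \<in> E \<rightarrow> carrier R \<and>
    r \<odot>\<^bsub>M\<^esub> y x = (\<Oplus>\<^bsub>M\<^esub>e\<in>E. c e \<odot>\<^bsub>M\<^esub> e)"
    if "x \<in> Y" for x
    using max_lin_indep_multiple_in_span[OF M R.one_not_zero S y[OF that]] .
  define good where "good x t \<longleftrightarrow> (case t of (r, E, c) \<Rightarrow> r \<in> carrier R \<and> r \<noteq> \<zero> \<and> E \<in> Fpow S \<and>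
    c \<in> E \<rightarrow> carrier R \<and> r \<odot>\<^bsub>M\<^esub> y x = (\<Oplus>\<^bsub>M\<^esub>e\<in>E. c e \<odot>\<^bsub>M\<^esub> e))" for x t
  have "\<forall>x\<in>Y. \<exists>t. good x t"
  proof
    fix x assume "x \<in> Y"
    from ex[OF this] obtain r E c where "good x (r, E, c)" unfolding good_def by auto
    then show "\<exists>t. good x t" ..
  qed
  then obtain t where t: "\<forall>x\<in>Y. good x (t x)" by (rule bchoice[THEN exE])
  define r E c where "r x = fst (t x)" and "E x = fst (snd (t x))" and "c x = snd (snd (t x))" for x
  have rEc: "r x \<in> carrier R \<and> r x \<noteq> \<zero> \<and> E x \<in> Fpow S \<and>
    c x \<in> E x \<rightarrow> carrier R \<and> r x \<odot>\<^bsub>M\<^esub> y x = (\<Oplus>\<^bsub>M\<^esub>e\<in>E x. c x e \<odot>\<^bsub>M\<^esub> e)" if "x \<in> Y" for x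
    using t[rule_format, OF that] by (simp add: good_def r_def E_def c_def split_beta)
  obtain E0 where E0: "E0 \<in> Fpow S" "infinite {x\<in>Y. E x = E0}"
    using ex_infinite_fiber_Fpow[OF Y, of E] rEc by blast
  \<comment> \<open>One element more than \<open>card E0\<close>, so that the unknowns of the linear
    system outnumber its equations.\<close>
  obtain F where F: "finite F" "card F = Suc (card E0)" "F \<subseteq> {x\<in>Y. E x = E0}"
    using infinite_arbitrarily_large[OF E0(2), of "Suc (card E0)"] by (elim exE conjE)
  have FY: "x \<in> Y" "E x = E0" if "x \<in> F" for x using F(3) that by auto
  have E0f: "finite E0" and E0c: "\<And>e. e \<in> E0 \<Longrightarrow> e \<in> carrier M"
    using E0(1) S by (auto simp: Fpow_def max_lin_indep_def lin_indep_def)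
  have cc: "c x e \<in> carrier R" if "x \<in> F" "e \<in> E0" for x e using rEc[OF FY(1)] FY(2) that by auto
  obtain d where d: "d \<in> F \<rightarrow> carrier R" "\<exists>x\<in>F. d x \<noteq> \<zero>" "\<forall>e\<in>E0. (\<Oplus>x\<in>F. d x \<otimes> c x e) = \<zero>"
    using R.ex_nontrivial_solution[OF E0f F(1), of c] F(2) cc by auto
  have dc: "d x \<in> carrier R" "r x \<in> carrier R" if "x \<in> F" for x using d(1) rEc[OF FY(1)] that by auto
  have "(\<Oplus>\<^bsub>M\<^esub>x\<in>F. (d x \<otimes> r x) \<odot>\<^bsub>M\<^esub> y x) = (\<Oplus>\<^bsub>M\<^esub>x\<in>F. \<Oplus>\<^bsub>M\<^esub>e\<in>E0. (d x \<otimes> c x e) \<odot>\<^bsub>M\<^esub> e)"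
  proof (intro M.finsum_cong')
    fix x assume x: "x \<in> F"
    have "(d x \<otimes> r x) \<odot>\<^bsub>M\<^esub> y x = d x \<odot>\<^bsub>M\<^esub> (\<Oplus>\<^bsub>M\<^esub>e\<in>E0. c x e \<odot>\<^bsub>M\<^esub> e)"
      using rEc[OF FY(1)[OF x]] dc[OF x] FY[OF x] y by (simp add: smult_assoc1)
    also have "\<dots> = (\<Oplus>\<^bsub>M\<^esub>e\<in>E0. d x \<odot>\<^bsub>M\<^esub> (c x e \<odot>\<^bsub>M\<^esub> e))"
      using E0f dc[OF x] cc[OF x] E0c by (intro finsum_smult_ldistr) auto
    also have "\<dots> = (\<Oplus>\<^bsub>M\<^esub>e\<in>E0. (d x \<otimes> c x e) \<odot>\<^bsub>M\<^esub> e)"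
      using dc[OF x] cc[OF x] E0c by (intro M.finsum_cong') (auto simp: smult_assoc1)
    finally show "(d x \<otimes> r x) \<odot>\<^bsub>M\<^esub> y x = (\<Oplus>\<^bsub>M\<^esub>e\<in>E0. (d x \<otimes> c x e) \<odot>\<^bsub>M\<^esub> e)" .
  qed (use dc cc E0c in \<open>auto intro!: M.finsum_closed\<close>)
  also have "\<dots> = (\<Oplus>\<^bsub>M\<^esub>e\<in>E0. \<Oplus>\<^bsub>M\<^esub>x\<in>F. (d x \<otimes> c x e) \<odot>\<^bsub>M\<^esub> e)"
    using F(1) E0f dc cc E0c by (intro M.finsum_swap) auto
  also have "\<dots> = \<zero>\<^bsub>M\<^esub>"
  proof (rule M.add.finprod_one_eqI)
    fix e assume e: "e \<in> E0"
    have "(\<Oplus>\<^bsub>M\<^esub>x\<in>F. (d x \<otimes> c x e) \<odot>\<^bsub>M\<^esub> e) = (\<Oplus>x\<in>F. d x \<otimes> c x e) \<odot>\<^bsub>M\<^esub> e"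
      using F(1) dc cc e E0c by (intro finsum_smult_rdistr[symmetric]) auto
    then show "(\<Oplus>\<^bsub>M\<^esub>x\<in>F. (d x \<otimes> c x e) \<odot>\<^bsub>M\<^esub> e) = \<zero>\<^bsub>M\<^esub>" using d(3) e E0c by simp
  qed
  finally have sum0: "(\<Oplus>\<^bsub>M\<^esub>x\<in>F. (d x \<otimes> r x) \<odot>\<^bsub>M\<^esub> y x) = \<zero>\<^bsub>M\<^esub>" .
  obtain x1 where x1: "x1 \<in> F" "d x1 \<noteq> \<zero>" using d(2) by auto
  have "d x1 \<otimes> r x1 \<noteq> \<zero>" using x1 dc rEc FY by (auto simp: R.integral_iff)
  then show ?thesis using F(1) FY(1) dc sum0 x1(1)
    by (intro exI[of _ F] exI[of _ "\<lambda>x. d x \<otimes> r x"]) auto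
qed

section \<open>Scaling relations and lifting from the residue field\<close>

text \<open>Divisibility is a total preorder here, so a finite nonempty family has a member of least
  value.\<close>

lemma (in valuation_ring) ex_common_divisor:
  assumes "finite F" "F \<noteq> {}" "d \<in> F \<rightarrow> carrier R"
  shows "\<exists>x0\<in>F. \<forall>x\<in>F. d x0 divides d x"
  using assms
proof (induction F rule: finite_ne_induct)
  case (singleton x) then show ?case by simp
next
  case (insert x F)
  then obtain x0 where x0: "x0 \<in> F" "\<forall>x\<in>F. d x0 divides d x" by auto
  have c: "d x \<in> carrier R" "d x0 \<in> carrier R" using insert.prems x0(1) by auto
  from divides_total[OF c] show ?case
  proof
    assume "d x divides d x0"
    then have "d x divides d y" if "y \<in> insert x F" for y
      using that x0(2) c by (auto intro: divides_trans)
    then show ?case by blast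
  qed (use x0 in auto)
qed

text \<open>Torsion-freeness makes it possible to divide a linear relation by a coefficient of least
  value, so that it stays nontrivial over the residue field.\<close>

lemma (in valuation_ring) ex_relation_with_unit_coefficient:
  fixes M :: "('a, 'n) module"
  assumes M: "module R M" and tf: "torsion_free R M"
    and F: "finite F" "d \<in> F \<rightarrow> carrier R" "\<exists>x\<in>F. d x \<noteq> \<zero>"
    and y: "\<And>x. x \<in> F \<Longrightarrow> y x \<in> carrier M" and rel: "(\<Oplus>\<^bsub>M\<^esub>x\<in>F. d x \<odot>\<^bsub>M\<^esub> y x) = \<zero>\<^bsub>M\<^esub>"
  shows "\<exists>e\<in>F \<rightarrow> carrier R. (\<exists>x\<in>F. e x = \<one>) \<and> (\<Oplus>\<^bsub>M\<^esub>x\<in>F. e x \<odot>\<^bsub>M\<^esub> y x) = \<zero>\<^bsub>M\<^esub>"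
proof -
  interpret M: module R M by (rule M)
  obtain x0 where x0: "x0 \<in> F" "\<forall>x\<in>F. d x0 divides d x"
    using ex_common_divisor[of F d] F by auto
  have dc: "d x \<in> carrier R" if "x \<in> F" for x using F(2) that by auto
  have "\<forall>x\<in>F. \<exists>q\<in>carrier R. d x = d x0 \<otimes> q" using x0(2) by (auto simp: factor_def)
  then obtain q where q: "\<And>x. x \<in> F \<Longrightarrow> q x \<in> carrier R \<and> d x = d x0 \<otimes> q x" by metis
  have d0: "d x0 \<noteq> \<zero>" using F(3) q by fastforce
  have "d x0 \<otimes> q x0 = d x0 \<otimes> \<one>" using q[OF x0(1)] dc[OF x0(1)] by simp
  then have q1: "q x0 = \<one>" using m_lcancel[OF d0 dc[OF x0(1)]] q[OF x0(1)] by blast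
  have "d x0 \<odot>\<^bsub>M\<^esub> (\<Oplus>\<^bsub>M\<^esub>x\<in>F. q x \<odot>\<^bsub>M\<^esub> y x) = (\<Oplus>\<^bsub>M\<^esub>x\<in>F. d x0 \<odot>\<^bsub>M\<^esub> (q x \<odot>\<^bsub>M\<^esub> y x))"
    using F(1) dc[OF x0(1)] q y by (intro M.finsum_smult_ldistr) auto
  also have "\<dots> = (\<Oplus>\<^bsub>M\<^esub>x\<in>F. d x \<odot>\<^bsub>M\<^esub> y x)"
  proof (intro M.finsum_cong')
    show "d x0 \<odot>\<^bsub>M\<^esub> (q x \<odot>\<^bsub>M\<^esub> y x) = d x \<odot>\<^bsub>M\<^esub> y x" if "x \<in> F" for x
      using M.smult_assoc1[OF dc[OF x0(1)], of "q x" "y x"] q[OF that] y[OF that] by metis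
  qed (use dc y in auto)
  finally have "d x0 \<odot>\<^bsub>M\<^esub> (\<Oplus>\<^bsub>M\<^esub>x\<in>F. q x \<odot>\<^bsub>M\<^esub> y x) = \<zero>\<^bsub>M\<^esub>" using rel by simp
  moreover have "(\<Oplus>\<^bsub>M\<^esub>x\<in>F. q x \<odot>\<^bsub>M\<^esub> y x) \<in> carrier M" using q y by (intro M.finsum_closed) auto
  ultimately have "(\<Oplus>\<^bsub>M\<^esub>x\<in>F. q x \<odot>\<^bsub>M\<^esub> y x) = \<zero>\<^bsub>M\<^esub>"
    using tf d0 dc[OF x0(1)] unfolding torsion_free_def by blast
  then show ?thesis using q q1 x0(1) by (intro bexI[of _ q]) auto
qed

lemma (in valuation_ring) field_residue_field: "field (residue_field R)"
  unfolding residue_field_def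
  using maximalideal.quotient_is_field[OF maximalideal_nonunits is_cring] .

text \<open>Lifts \<open>l x\<close> of the functions \<open>v x\<close> are applied to
  \<open>a\<close> coordinatewise. The images under \<open>f\<close> satisfy a relation with a
  coefficient 1, and \<open>u\<close> is the same combination of the lifts. Modulo the non-units,
  \<open>u\<close> becomes a nontrivial combination of the \<open>v x\<close>, whose zeros are
  exactly the non-unit coordinates of \<open>u\<close>.\<close>

lemma (in valuation_ring) ex_scalars_annihilating:
  assumes A: "\<And>i. i \<in> I \<Longrightarrow> nonassoc_algebra R (A i)"
    and B: "nonassoc_algebra R B" and tf: "torsion_free R B"
    and f: "f \<in> alg_hom R (alg_prod I A) B"
    and S: "max_lin_indep R B S" and Y: "infinite Y" "|S| <o |Y|"
    and v: "cofinitely_independent (residue_field R) Y I v"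
    and a: "a \<in> carrier (alg_prod I A)"
  shows "\<exists>u. (\<forall>i\<in>I. u i \<in> carrier R) \<and> finite {i\<in>I. u i \<notin> Units R} \<and>
    f (\<lambda>i\<in>I. u i \<odot>\<^bsub>A i\<^esub> a i) = \<zero>\<^bsub>B\<^esub>"
proof -
  interpret K: field "residue_field R" by (rule field_residue_field)
  interpret B: nonassoc_algebra R B by (rule B)
  interpret P: nonassoc_algebra R "alg_prod I A"
    by (rule nonassoc_algebra_alg_prod[OF is_cring A])
  define N where "N = carrier R - Units R"
  interpret N: ideal N R
    unfolding N_def using maximalideal_nonunits by (rule maximalideal.axioms)
  have KN: "residue_field R = R Quot N" by (simp add: residue_field_def N_def)
  interpret \<pi>: ring_hom_ring R "residue_field R" "(+>) N"
    unfolding KN by (rule N.rcos_ring_hom_ring)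
  have mi: "module R (A i)" if "i \<in> I" for i using A[OF that] by (rule nonassoc_algebra.axioms)
  have ai: "a i \<in> carrier (A i)" if "i \<in> I" for i using a that by (auto simp: alg_prod_def)
  have lift: "\<exists>r\<in>carrier R. N +> r = k" if "k \<in> carrier (residue_field R)" for k
  proof -
    have "k \<in> (\<Union>r\<in>carrier R. {N +> r})" using that unfolding KN FactRing_def A_RCOSETS_def' by simp
    then show ?thesis by blast
  qed
  define l where "l x i = (SOME r. r \<in> carrier R \<and> N +> r = v x i)" for x i
  have l: "l x i \<in> carrier R \<and> N +> l x i = v x i" if xi: "x \<in> Y" "i \<in> I" for x i
  proof -
    have "v x i \<in> carrier (residue_field R)" using v xi by (simp add: cofinitely_independent_def)
    then show ?thesis unfolding l_def using lift someI_ex[of "\<lambda>r. r \<in> carrier R \<and> N +> r = v x i"] by blast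
  qed
  define sc where "sc u = (\<lambda>i\<in>I. u i \<odot>\<^bsub>A i\<^esub> a i)" for u
  have scc: "sc u \<in> carrier (alg_prod I A)" if "\<And>i. i \<in> I \<Longrightarrow> u i \<in> carrier R" for u
    using that ai module.smult_closed[OF mi] by (auto simp: sc_def alg_prod_def)
  have f_closed: "f x \<in> carrier B" if "x \<in> carrier (alg_prod I A)" for x
    using f that by (auto simp: alg_hom_def)
  have f_add: "f (x \<oplus>\<^bsub>alg_prod I A\<^esub> y) = f x \<oplus>\<^bsub>B\<^esub> f y"
    if "x \<in> carrier (alg_prod I A)" "y \<in> carrier (alg_prod I A)" for x y
    using f that by (auto simp: alg_hom_def)
  have f_smult: "f (r \<odot>\<^bsub>alg_prod I A\<^esub> x) = r \<odot>\<^bsub>B\<^esub> f x"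
    if "r \<in> carrier R" "x \<in> carrier (alg_prod I A)" for r x
    using f that by (auto simp: alg_hom_def)
  define y where "y x = f (sc (l x))" for x
  have yc: "y x \<in> carrier B" if "x \<in> Y" for x unfolding y_def using l that by (intro f_closed scc) auto
  obtain F d where F: "finite F" "F \<subseteq> Y" "d \<in> F \<rightarrow> carrier R" "\<exists>x\<in>F. d x \<noteq> \<zero>"
    "(\<Oplus>\<^bsub>B\<^esub>x\<in>F. d x \<odot>\<^bsub>B\<^esub> y x) = \<zero>\<^bsub>B\<^esub>"
    using ex_linear_relation[OF B.module_axioms domain_axioms S Y, of y] yc by blast
  obtain e where e: "e \<in> F \<rightarrow> carrier R" "\<exists>x\<in>F. e x = \<one>" "(\<Oplus>\<^bsub>B\<^esub>x\<in>F. e x \<odot>\<^bsub>B\<^esub> y x) = \<zero>\<^bsub>B\<^esub>"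
    using ex_relation_with_unit_coefficient[OF B.module_axioms tf F(1,3,4), of y] F(5) yc F(2) by blast
  \<comment> \<open>The index set \<open>G\<close> is a parameter so that linearity of
    \<open>f\<close> can be applied one summand at a time, by induction on \<open>G\<close>.\<close>
  define u where "u G i = (\<Oplus>x\<in>G. e x \<otimes> l x i)" for G i
  have ec: "e x \<in> carrier R" if "x \<in> F" for x using e(1) that by auto
  have lc: "l x i \<in> carrier R" if "x \<in> F" "i \<in> I" for x i using l that F(2) by blast
  have uc: "u G i \<in> carrier R" if "G \<subseteq> F" "i \<in> I" for G i
    unfolding u_def using that ec lc by (intro finsum_closed) auto
  have "f (sc (u G)) = (\<Oplus>\<^bsub>B\<^esub>x\<in>G. e x \<odot>\<^bsub>B\<^esub> y x)" if "finite G" "G \<subseteq> F" for G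
    using that
  proof (induction G)
    case empty
    have "sc (u {}) = \<zero> \<odot>\<^bsub>alg_prod I A\<^esub> a"
      by (auto simp: sc_def u_def alg_prod_def)
    then show ?case using f_smult[OF zero_closed a] f_closed[OF a] by simp
  next
    case (insert x G)
    have x: "x \<in> F" "x \<in> Y" and G: "G \<subseteq> F" using insert.prems F(2) by auto
    have uG: "u (insert x G) i = e x \<otimes> l x i \<oplus> u G i" if "i \<in> I" for i
      unfolding u_def using that insert.hyps x(1) G ec lc by (intro finsum_insert) auto
    have "sc (u (insert x G)) = e x \<odot>\<^bsub>alg_prod I A\<^esub> sc (l x) \<oplus>\<^bsub>alg_prod I A\<^esub> sc (u G)"
      using uG uc[OF G] lc[OF x(1)] ec[OF x(1)] ai
      by (auto simp: sc_def alg_prod_def module.smult_l_distr[OF mi] module.smult_assoc1[OF mi])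
    moreover have "sc (l x) \<in> carrier (alg_prod I A)" "sc (u G) \<in> carrier (alg_prod I A)"
      using lc[OF x(1)] uc[OF G] by (auto intro!: scc)
    ultimately have "f (sc (u (insert x G))) = e x \<odot>\<^bsub>B\<^esub> y x \<oplus>\<^bsub>B\<^esub> (\<Oplus>\<^bsub>B\<^esub>x\<in>G. e x \<odot>\<^bsub>B\<^esub> y x)"
      using insert.IH[OF G] ec[OF x(1)] by (simp add: f_add f_smult y_def)
    also have "\<dots> = (\<Oplus>\<^bsub>B\<^esub>x\<in>insert x G. e x \<odot>\<^bsub>B\<^esub> y x)"
    proof (rule B.M.finsum_insert[symmetric])
      have "y x' \<in> carrier B" if "x' \<in> F" for x' using yc F(2) that by blast
      then show "(\<lambda>x. e x \<odot>\<^bsub>B\<^esub> y x) \<in> G \<rightarrow> carrier B" "e x \<odot>\<^bsub>B\<^esub> y x \<in> carrier B"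
        using G x(1) ec by auto
    qed (use insert.hyps in auto)
    finally show ?case .
  qed
  then have fu: "f (sc (u F)) = \<zero>\<^bsub>B\<^esub>" using e(3) F(1) by simp
  have \<pi>u: "N +> u F i = (\<Oplus>\<^bsub>residue_field R\<^esub>x\<in>F. (N +> e x) \<otimes>\<^bsub>residue_field R\<^esub> v x i)" if i: "i \<in> I" for i
  proof -
    have "N +> u F i = (\<Oplus>\<^bsub>residue_field R\<^esub>x\<in>F. N +> (e x \<otimes> l x i))"
      unfolding u_def using i ec lc by (subst \<pi>.hom_finsum) (auto simp: o_def)
    also have "\<dots> = (\<Oplus>\<^bsub>residue_field R\<^esub>x\<in>F. (N +> e x) \<otimes>\<^bsub>residue_field R\<^esub> v x i)"
    proof (intro K.finsum_cong')
      fix x assume x: "x \<in> F"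
      then have "v x i = N +> l x i" using l F(2) i by auto
      then show "N +> (e x \<otimes> l x i) = (N +> e x) \<otimes>\<^bsub>residue_field R\<^esub> v x i"
        using ec[OF x] lc[OF x i] by simp
    next
      show "(\<lambda>x. (N +> e x) \<otimes>\<^bsub>residue_field R\<^esub> v x i) \<in> F \<rightarrow> carrier (residue_field R)"
        using ec v i F(2) by (auto simp: cofinitely_independent_def)
    qed simp
    finally show ?thesis .
  qed
  have N0: "N +> r = \<zero>\<^bsub>residue_field R\<^esub>" if "r \<in> N" for r
    using N.a_rcos_const[OF that] unfolding KN FactRing_def by simp
  have "finite {i\<in>I. (\<Oplus>\<^bsub>residue_field R\<^esub>x\<in>F. (N +> e x) \<otimes>\<^bsub>residue_field R\<^esub> v x i) = \<zero>\<^bsub>residue_field R\<^esub>}"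
  proof -
    \<comment> \<open>The coefficient 1 survives reduction modulo \<open>N\<close>, so the
      combination over the residue field is nontrivial.\<close>
    obtain x1 where "x1 \<in> F" "e x1 = \<one>" using e(2) by auto
    then have "\<exists>x\<in>F. N +> e x \<noteq> \<zero>\<^bsub>residue_field R\<^esub>" by (intro bexI[of _ x1]) auto
    moreover have "(\<lambda>x. N +> e x) \<in> F \<rightarrow> carrier (residue_field R)" using ec by auto
    ultimately show ?thesis using v F(1,2) unfolding cofinitely_independent_def
      by (elim conjE allE[of _ F] allE[of _ "\<lambda>x. N +> e x"]) auto
  qed
  then have "finite {i\<in>I. u F i \<notin> Units R}"
  proof (rule rev_finite_subset)
    show "{i\<in>I. u F i \<notin> Units R} \<subseteq>
      {i\<in>I. (\<Oplus>\<^bsub>residue_field R\<^esub>x\<in>F. (N +> e x) \<otimes>\<^bsub>residue_field R\<^esub> v x i) = \<zero>\<^bsub>residue_field R\<^esub>}"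
      using uc[of F] N0 \<pi>u by (force simp: N_def)
  qed
  then show ?thesis using uc[of F] fu by (intro exI[of _ "u F"]) (auto simp: sc_def)
qed

section \<open>Surjections from direct products\<close>

context nonassoc_algebra
begin

lemma zero_mult [simp]: "x \<in> carrier M \<Longrightarrow> \<zero>\<^bsub>M\<^esub> \<otimes>\<^bsub>M\<^esub> x = \<zero>\<^bsub>M\<^esub>"
  using mult_smult_left[of \<zero> "\<zero>\<^bsub>M\<^esub>" x] mult_closed[of "\<zero>\<^bsub>M\<^esub>" x] by simp

lemma mult_zero [simp]: "x \<in> carrier M \<Longrightarrow> x \<otimes>\<^bsub>M\<^esub> \<zero>\<^bsub>M\<^esub> = \<zero>\<^bsub>M\<^esub>"
  using mult_smult_right[of \<zero> x "\<zero>\<^bsub>M\<^esub>"] mult_closed[of x "\<zero>\<^bsub>M\<^esub>"] by simp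

end

text \<open>\<open>scalars\<close> carries what the rank, the residue field and torsion-freeness
  contribute; the rest of the argument concerns products and supports.\<close>

locale product_algebra_epi =
  fixes R :: "('r, 'm) ring_scheme" (structure)
    and A :: "'i \<Rightarrow> ('r, 'a) module" and I :: "'i set"
    and B :: "('r, 'b) module" and f :: "('i \<Rightarrow> 'a) \<Rightarrow> 'b"
  assumes cring_R: "cring R"
    and A: "\<And>i. i \<in> I \<Longrightarrow> nonassoc_algebra R (A i)"
    and B: "nonassoc_algebra R B"
    and f: "f \<in> alg_hom R (alg_prod I A) B"
    and surj: "f ` carrier (alg_prod I A) = carrier B"
    and scalars: "\<And>a. a \<in> carrier (alg_prod I A) \<Longrightarrow>
      \<exists>u. (\<forall>i\<in>I. u i \<in> carrier R) \<and> finite {i\<in>I. u i \<notin> Units R} \<and>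
        f (\<lambda>i\<in>I. u i \<odot>\<^bsub>A i\<^esub> a i) = \<zero>\<^bsub>B\<^esub>"
begin

abbreviation "P \<equiv> alg_prod I A"
abbreviation "Z \<equiv> total_annihilator B"

sublocale P: nonassoc_algebra R P
  by (rule nonassoc_algebra_alg_prod[OF cring_R A])

sublocale B: nonassoc_algebra R B
  by (rule B)

lemmas A_module = nonassoc_algebra.axioms(1)[OF A]
lemmas A_group = module.axioms(2)[OF A_module]
lemmas A_monoid = abelian_group.axioms(1)[OF A_group]

text \<open>Only the values of \<open>a\<close> on \<open>J \<inter> I\<close> enter, so
  \<open>cut\<close> applies to elements of \<open>P\<close>, to elements of a subproduct, and to
  functions known to lie in the factors only on \<open>J\<close>.\<close>

definition cut :: "'i set \<Rightarrow> ('i \<Rightarrow> 'a) \<Rightarrow> 'i \<Rightarrow> 'a" where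
  "cut J a = (\<lambda>i\<in>I. if i \<in> J then a i else \<zero>\<^bsub>A i\<^esub>)"

lemma P_component: "a \<in> carrier P \<Longrightarrow> i \<in> I \<Longrightarrow> a i \<in> carrier (A i)"
  by (auto simp: alg_prod_def)

lemma zero_component: "i \<in> I \<Longrightarrow> \<zero>\<^bsub>A i\<^esub> \<in> carrier (A i)"
  by (rule abelian_monoid.zero_closed[OF A_monoid])

lemma cut_closed_partial: "(\<And>i. i \<in> J \<Longrightarrow> i \<in> I \<Longrightarrow> a i \<in> carrier (A i)) \<Longrightarrow> cut J a \<in> carrier P"
  using zero_component by (auto simp: cut_def alg_prod_def)

lemma cut_closed [simp]: "a \<in> carrier P \<Longrightarrow> cut J a \<in> carrier P"
  using P_component by (intro cut_closed_partial)

lemma P_eqI: "a \<in> carrier P \<Longrightarrow> b \<in> carrier P \<Longrightarrow> (\<And>i. i \<in> I \<Longrightarrow> a i = b i) \<Longrightarrow> a = b"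
  unfolding alg_prod_def by (auto intro: PiE_ext)

lemma mult_component [simp]: "i \<in> I \<Longrightarrow> (a \<otimes>\<^bsub>P\<^esub> b) i = a i \<otimes>\<^bsub>A i\<^esub> b i"
  and add_component [simp]: "i \<in> I \<Longrightarrow> (a \<oplus>\<^bsub>P\<^esub> b) i = a i \<oplus>\<^bsub>A i\<^esub> b i"
  and cut_component [simp]: "i \<in> I \<Longrightarrow> cut J a i = (if i \<in> J then a i else \<zero>\<^bsub>A i\<^esub>)"
  by (simp_all add: alg_prod_def cut_def)

lemma A_simps [simp]:
  assumes "i \<in> I" "x \<in> carrier (A i)"
  shows "x \<otimes>\<^bsub>A i\<^esub> \<zero>\<^bsub>A i\<^esub> = \<zero>\<^bsub>A i\<^esub>" "\<zero>\<^bsub>A i\<^esub> \<otimes>\<^bsub>A i\<^esub> x = \<zero>\<^bsub>A i\<^esub>"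
    "x \<oplus>\<^bsub>A i\<^esub> \<zero>\<^bsub>A i\<^esub> = x" "\<zero>\<^bsub>A i\<^esub> \<oplus>\<^bsub>A i\<^esub> x = x"
  using nonassoc_algebra.mult_zero[OF A] nonassoc_algebra.zero_mult[OF A]
    abelian_monoid.r_zero[OF A_monoid] abelian_monoid.l_zero[OF A_monoid] assms by auto

lemma f_closed [simp]: "x \<in> carrier P \<Longrightarrow> f x \<in> carrier B"
  and f_add: "x \<in> carrier P \<Longrightarrow> y \<in> carrier P \<Longrightarrow> f (x \<oplus>\<^bsub>P\<^esub> y) = f x \<oplus>\<^bsub>B\<^esub> f y"
  and f_mult: "x \<in> carrier P \<Longrightarrow> y \<in> carrier P \<Longrightarrow> f (x \<otimes>\<^bsub>P\<^esub> y) = f x \<otimes>\<^bsub>B\<^esub> f y"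
  and f_smult: "r \<in> carrier R \<Longrightarrow> x \<in> carrier P \<Longrightarrow> f (r \<odot>\<^bsub>P\<^esub> x) = r \<odot>\<^bsub>B\<^esub> f x"
  using f by (auto simp: alg_hom_def)

text \<open>Surjectivity of \<open>f\<close> makes it enough to test products with images
  \<open>f b\<close>.\<close>

lemma f_in_annihilatorI:
  assumes "a \<in> carrier P"
    and "\<And>b. b \<in> carrier P \<Longrightarrow> f a \<otimes>\<^bsub>B\<^esub> f b = \<zero>\<^bsub>B\<^esub>" "\<And>b. b \<in> carrier P \<Longrightarrow> f b \<otimes>\<^bsub>B\<^esub> f a = \<zero>\<^bsub>B\<^esub>"
  shows "f a \<in> Z"
  using assms by (auto simp: total_annihilator_def simp flip: surj)

lemma annihilator_add: "x \<in> Z \<Longrightarrow> y \<in> Z \<Longrightarrow> x \<oplus>\<^bsub>B\<^esub> y \<in> Z"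
  by (auto simp: total_annihilator_def B.mult_add_left B.mult_add_right)

lemma annihilator_zero: "\<zero>\<^bsub>B\<^esub> \<in> Z"
  by (auto simp: total_annihilator_def)

lemma f_zero: "f \<zero>\<^bsub>P\<^esub> = \<zero>\<^bsub>B\<^esub>"
  using f_smult[of "\<zero>" "\<zero>\<^bsub>P\<^esub>"] by simp

lemma f_cut_empty: "f (cut {} a) = \<zero>\<^bsub>B\<^esub>"
proof -
  have "cut {} a = \<zero>\<^bsub>P\<^esub>" by (auto simp: cut_def alg_prod_def)
  then show ?thesis by (simp add: f_zero)
qed

lemma f_cut_Un:
  assumes "a \<in> carrier P" "J \<inter> K = {}"
  shows "f (cut (J \<union> K) a) = f (cut J a) \<oplus>\<^bsub>B\<^esub> f (cut K a)"
proof -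
  have "cut (J \<union> K) a = cut J a \<oplus>\<^bsub>P\<^esub> cut K a"
    using assms by (intro P_eqI) (auto simp: P_component zero_component)
  then show ?thesis using assms by (simp add: f_add)
qed

lemma cut_all: "a \<in> carrier P \<Longrightarrow> cut I a = a"
  by (intro P_eqI) auto

lemma cut_cut: "cut J (cut K a) = cut (J \<inter> K) a"
  by (auto simp: cut_def)

text \<open>Off the finite set \<open>J\<close> where \<open>u\<close> is not invertible, \<open>a b = (u a) (u\<^sup>-\<^sup>1 b)\<close>, and \<open>f (u a) = 0\<close>.\<close>

lemma ex_finite_cofinite_part_in_annihilator:
  assumes a: "a \<in> carrier P"
  shows "\<exists>J. finite J \<and> J \<subseteq> I \<and> f (cut (I - J) a) \<in> Z"
proof -
  obtain u where u: "\<forall>i\<in>I. u i \<in> carrier R" "finite {i\<in>I. u i \<notin> Units R}"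
    "f (\<lambda>i\<in>I. u i \<odot>\<^bsub>A i\<^esub> a i) = \<zero>\<^bsub>B\<^esub>"
    using scalars[OF a] by blast
  define J where "J = {i\<in>I. u i \<notin> Units R}"
  define ua where "ua = (\<lambda>i\<in>I. u i \<odot>\<^bsub>A i\<^esub> a i)"
  have ua: "ua \<in> carrier P"
    using u(1) P_component[OF a] module.smult_closed[OF A_module] by (auto simp: ua_def alg_prod_def)
  have "f (cut (I - J) a) \<in> Z"
  proof (rule f_in_annihilatorI)
    fix b assume b: "b \<in> carrier P"
    \<comment> \<open>Inverses are available only off \<open>J\<close>. On \<open>J\<close> both
      products vanish, because \<open>cut (I - J) a\<close> and \<open>b'\<close> are zero
      there.\<close>
    define b' where "b' = cut (I - J) (\<lambda>i. inv (u i) \<odot>\<^bsub>A i\<^esub> b i)"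
    have unit: "inv (u i) \<in> carrier R" "u i \<otimes> inv (u i) = \<one>" "inv (u i) \<otimes> u i = \<one>" "u i \<in> carrier R"
      if "i \<in> I - J" for i
      using that by (auto simp: J_def)
    have b': "b' \<in> carrier P" unfolding b'_def
      using unit P_component[OF b] module.smult_closed[OF A_module] by (intro cut_closed_partial) auto
    have "cut (I - J) a \<otimes>\<^bsub>P\<^esub> b = ua \<otimes>\<^bsub>P\<^esub> b' \<and> b \<otimes>\<^bsub>P\<^esub> cut (I - J) a = b' \<otimes>\<^bsub>P\<^esub> ua"
    proof -
      have "(cut (I - J) a \<otimes>\<^bsub>P\<^esub> b) i = (ua \<otimes>\<^bsub>P\<^esub> b') i \<and> (b \<otimes>\<^bsub>P\<^esub> cut (I - J) a) i = (b' \<otimes>\<^bsub>P\<^esub> ua) i"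
        if i: "i \<in> I" for i
      proof (cases "i \<in> J")
        case True
        then show ?thesis using i P_component[OF b i] P_component[OF ua i] by (simp add: b'_def)
      next
        case False
        interpret Ai: nonassoc_algebra R "A i" by (rule A[OF i])
        have iJ: "i \<in> I - J" using i False by blast
        note c = P_component[OF a i] P_component[OF b i] unit[OF iJ]
        have "(u i \<odot>\<^bsub>A i\<^esub> a i) \<otimes>\<^bsub>A i\<^esub> (inv (u i) \<odot>\<^bsub>A i\<^esub> b i) = a i \<otimes>\<^bsub>A i\<^esub> b i"
          using c by (simp add: Ai.mult_smult_left Ai.mult_smult_right Ai.mult_closed flip: Ai.smult_assoc1)
        moreover have "(inv (u i) \<odot>\<^bsub>A i\<^esub> b i) \<otimes>\<^bsub>A i\<^esub> (u i \<odot>\<^bsub>A i\<^esub> a i) = b i \<otimes>\<^bsub>A i\<^esub> a i"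
          using c by (simp add: Ai.mult_smult_left Ai.mult_smult_right Ai.mult_closed flip: Ai.smult_assoc1)
        ultimately show ?thesis using i False by (simp add: b'_def ua_def)
      qed
      then show ?thesis using a b b' ua
        by (intro conjI P_eqI P.mult_closed cut_closed) blast+
    qed
    moreover have "f ua = \<zero>\<^bsub>B\<^esub>" using u(3) by (simp add: ua_def)
    ultimately have "f (cut (I - J) a \<otimes>\<^bsub>P\<^esub> b) = \<zero>\<^bsub>B\<^esub>" "f (b \<otimes>\<^bsub>P\<^esub> cut (I - J) a) = \<zero>\<^bsub>B\<^esub>"
      using ua b' by (simp_all add: f_mult)
    then show "f (cut (I - J) a) \<otimes>\<^bsub>B\<^esub> f b = \<zero>\<^bsub>B\<^esub>" "f b \<otimes>\<^bsub>B\<^esub> f (cut (I - J) a) = \<zero>\<^bsub>B\<^esub>"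
      using a b by (simp_all add: f_mult)
  qed (use a in simp)
  moreover have "finite J" "J \<subseteq> I" using u(2) by (auto simp: J_def)
  ultimately show ?thesis by blast
qed

section \<open>Essential factors\<close>

text \<open>\<open>cut {i} x\<close> ranges over the copy of \<open>A i\<close> inside the product,
  so these are the factors whose image in \<open>B\<close> has nonzero multiplication. Images of
  distinct factors always annihilate each other.\<close>

definition essential :: "'i set" where
  "essential = {i\<in>I. \<exists>x\<in>carrier P. \<exists>y\<in>carrier P. f (cut {i} x) \<otimes>\<^bsub>B\<^esub> f (cut {i} y) \<noteq> \<zero>\<^bsub>B\<^esub>}"

text \<open>Witnesses \<open>x i\<close> for all essential \<open>i\<close> can be collected into one element of the product;
  as a cofinite part of it is mapped into \<open>Z\<close>, all but finitely many of them are no witnesses.\<close>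

lemma finite_essential: "finite essential"
proof -
  have ex: "\<exists>x y. x \<in> carrier P \<and> y \<in> carrier P \<and> f (cut {i} x) \<otimes>\<^bsub>B\<^esub> f (cut {i} y) \<noteq> \<zero>\<^bsub>B\<^esub>"
    if "i \<in> essential" for i
    using that by (auto simp: essential_def)
  then obtain x y where xy: "\<And>i. i \<in> essential \<Longrightarrow> x i \<in> carrier P \<and> y i \<in> carrier P \<and>
      f (cut {i} (x i)) \<otimes>\<^bsub>B\<^esub> f (cut {i} (y i)) \<noteq> \<zero>\<^bsub>B\<^esub>"
    by metis
  \<comment> \<open>A diagonal element: coordinate \<open>i\<close> is taken from the witness chosen
    for \<open>i\<close>.\<close>
  define a where "a = cut essential (\<lambda>i. x i i)"
  have a: "a \<in> carrier P" unfolding a_def using xy P_component by (intro cut_closed_partial) blast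
  obtain J where J: "finite J" "J \<subseteq> I" "f (cut (I - J) a) \<in> Z"
    using ex_finite_cofinite_part_in_annihilator[OF a] by blast
  have "essential \<subseteq> J"
  proof
    fix i assume i: "i \<in> essential"
    show "i \<in> J"
    proof (rule ccontr)
      assume "i \<notin> J"
      have iI: "i \<in> I" using i by (simp add: essential_def)
      have xi: "x i \<in> carrier P" "y i \<in> carrier P" using xy[OF i] by auto
      \<comment> \<open>Multiplication by an element supported at \<open>i\<close> sees only
        coordinate \<open>i\<close>, where \<open>a\<close> and \<open>x i\<close> agree; the cut to
        \<open>I - J\<close> keeps this coordinate since \<open>i \<notin> J\<close>.\<close>
      have "cut {i} (x i) \<otimes>\<^bsub>P\<^esub> cut {i} (y i) = cut (I - J) a \<otimes>\<^bsub>P\<^esub> cut {i} (y i)"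
      proof (intro P_eqI P.mult_closed cut_closed xi a)
        fix j assume j: "j \<in> I"
        have "cut (I - J) a j \<in> carrier (A j)" using a j by (intro P_component cut_closed)
        then show "(cut {i} (x i) \<otimes>\<^bsub>P\<^esub> cut {i} (y i)) j = (cut (I - J) a \<otimes>\<^bsub>P\<^esub> cut {i} (y i)) j"
          using j i \<open>i \<notin> J\<close> zero_component[OF j] by (auto simp: a_def)
      qed
      then have "f (cut {i} (x i)) \<otimes>\<^bsub>B\<^esub> f (cut {i} (y i)) = f (cut (I - J) a) \<otimes>\<^bsub>B\<^esub> f (cut {i} (y i))"
        using xi a by (simp flip: f_mult)
      also have "\<dots> = \<zero>\<^bsub>B\<^esub>" using J(3) xi by (simp add: total_annihilator_def)
      finally show False using xy[OF i] by blast
    qed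
  qed
  then show ?thesis using J(1) finite_subset by blast
qed

lemma essential_subset: "essential \<subseteq> I"
  by (auto simp: essential_def)

text \<open>A product with an element supported at \<open>i\<close> depends only on coordinate
  \<open>i\<close> of \<open>b\<close>, and \<open>f\<close> maps products inside an inessential
  factor to zero.\<close>

lemma f_cut_single_in_annihilator:
  assumes "i \<in> I - essential" "a \<in> carrier P"
  shows "f (cut {i} a) \<in> Z"
proof (rule f_in_annihilatorI)
  fix b assume b: "b \<in> carrier P"
  have i: "f (cut {i} x) \<otimes>\<^bsub>B\<^esub> f (cut {i} y) = \<zero>\<^bsub>B\<^esub>" if "x \<in> carrier P" "y \<in> carrier P" for x y
    using assms(1) that by (auto simp: essential_def)
  have "cut {i} a \<otimes>\<^bsub>P\<^esub> b = cut {i} a \<otimes>\<^bsub>P\<^esub> cut {i} b" "b \<otimes>\<^bsub>P\<^esub> cut {i} a = cut {i} b \<otimes>\<^bsub>P\<^esub> cut {i} a"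
    using assms(2) b P_component[OF b] zero_component
    by (auto intro!: P_eqI P.mult_closed)
  then show "f (cut {i} a) \<otimes>\<^bsub>B\<^esub> f b = \<zero>\<^bsub>B\<^esub>" "f b \<otimes>\<^bsub>B\<^esub> f (cut {i} a) = \<zero>\<^bsub>B\<^esub>"
    using i assms(2) b by (metis cut_closed f_mult)+
qed (use assms in simp)

lemma f_cut_finite_in_annihilator:
  assumes "finite K" "K \<subseteq> I - essential" "a \<in> carrier P"
  shows "f (cut K a) \<in> Z"
  using assms
proof (induction K)
  case empty then show ?case by (simp add: f_cut_empty annihilator_zero)
next
  case (insert i K)
  have "f (cut (insert i K) a) = f (cut {i} a) \<oplus>\<^bsub>B\<^esub> f (cut K a)"
    using f_cut_Un[of a "{i}" K] insert by simp
  then show ?case using insert f_cut_single_in_annihilator by (simp add: annihilator_add)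
qed

text \<open>The finite exceptional set \<open>J\<close> depends on \<open>a\<close>, whereas
  \<open>essential\<close> does not. Passing from one to the other involves only the finitely many
  inessential coordinates in \<open>J\<close>, each of which contributes an element of
  \<open>Z\<close>.\<close>

lemma f_cut_inessential_in_annihilator:
  assumes a: "a \<in> carrier P"
  shows "f (cut (I - essential) a) \<in> Z"
proof -
  obtain J where J: "finite J" "J \<subseteq> I" "f (cut (I - J) (cut (I - essential) a)) \<in> Z"
    using ex_finite_cofinite_part_in_annihilator[of "cut (I - essential) a"] a by auto
  have "f (cut (J - essential) a) \<in> Z"
    using J(1,2) a by (intro f_cut_finite_in_annihilator) auto
  moreover have "f (cut ((I - J) \<inter> (I - essential)) a) \<in> Z" using J(3) by (simp add: cut_cut)
  moreover have "f (cut ((J - essential) \<union> ((I - J) \<inter> (I - essential))) a) =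
      f (cut (J - essential) a) \<oplus>\<^bsub>B\<^esub> f (cut ((I - J) \<inter> (I - essential)) a)"
    using a by (intro f_cut_Un) auto
  moreover have "(J - essential) \<union> ((I - J) \<inter> (I - essential)) = I - essential" using J(2) by blast
  ultimately show ?thesis using annihilator_add by metis
qed

section \<open>The decomposition of \<open>f\<close>\<close>

lemma f_split:
  assumes "a \<in> carrier P"
  shows "f a = f (cut essential a) \<oplus>\<^bsub>B\<^esub> f (cut (I - essential) a)"
proof -
  have "essential \<union> (I - essential) = I" using essential_subset by blast
  then show ?thesis using f_cut_Un[OF assms, of essential "I - essential"] cut_all[OF assms] by simp
qed

text \<open>Cutting and extending by zero respect all operations. The case \<open>K = I\<close>
  yields both summands of \<open>f\<close>, and \<open>J = K = essential\<close> yields the map on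
  the finite subproduct.\<close>

lemma f_cut_hom:
  assumes "J \<subseteq> K" "K \<subseteq> I"
  shows "(\<lambda>a. f (cut J a)) \<in> alg_hom R (alg_prod K A) B"
proof -
  have comp: "a i \<in> carrier (A i)" if "a \<in> carrier (alg_prod K A)" "i \<in> J" for a i
    using that assms by (auto simp: alg_prod_def)
  have cl: "cut J a \<in> carrier P" if "a \<in> carrier (alg_prod K A)" for a
    using comp[OF that] by (intro cut_closed_partial) auto
  have "cut J (a \<oplus>\<^bsub>alg_prod K A\<^esub> b) = cut J a \<oplus>\<^bsub>P\<^esub> cut J b"
    "cut J (a \<otimes>\<^bsub>alg_prod K A\<^esub> b) = cut J a \<otimes>\<^bsub>P\<^esub> cut J b" for a b
    using assms zero_component by (auto simp: cut_def alg_prod_def fun_eq_iff subset_iff)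
  moreover have "cut J (r \<odot>\<^bsub>alg_prod K A\<^esub> a) = r \<odot>\<^bsub>P\<^esub> cut J a" if "r \<in> carrier R" for r a
    using assms that module.smult_r_null[OF A_module]
    by (auto simp: cut_def alg_prod_def fun_eq_iff subset_iff)
  ultimately show ?thesis using cl unfolding alg_hom_def by (simp add: f_add f_mult f_smult)
qed

lemma carrier_decomposition: "carrier B = f ` alg_fin I A <+>\<^bsub>B\<^esub> Z"
proof
  show "carrier B \<subseteq> f ` alg_fin I A <+>\<^bsub>B\<^esub> Z"
  proof
    fix y assume "y \<in> carrier B"
    then obtain a where a: "a \<in> carrier P" "y = f a" using surj by auto
    have "alg_supp I A (cut essential a) \<subseteq> essential" by (auto simp: alg_supp_def split: if_splits)
    then have "cut essential a \<in> alg_fin I A"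
      using a finite_essential finite_subset by (auto simp: alg_fin_def)
    then show "y \<in> f ` alg_fin I A <+>\<^bsub>B\<^esub> Z"
      using f_split[OF a(1)] f_cut_inessential_in_annihilator[OF a(1)] a(2)
      unfolding set_add_def' by blast
  qed
  show "f ` alg_fin I A <+>\<^bsub>B\<^esub> Z \<subseteq> carrier B"
    unfolding set_add_def' by (auto simp: alg_fin_def total_annihilator_def)
qed

lemma f_decomposition:
  "\<exists>f\<^sub>1 \<in> alg_hom R P B. \<exists>f\<^sub>0 \<in> alg_hom R P B.
     (\<exists>J g. J \<subseteq> I \<and> finite J \<and> g \<in> alg_hom R (alg_prod J A) B \<and>
        (\<forall>a\<in>carrier P. f\<^sub>1 a = g (restrict a J))) \<and>
     f\<^sub>0 ` carrier P \<subseteq> Z \<and> (\<forall>a\<in>carrier P. f a = f\<^sub>1 a \<oplus>\<^bsub>B\<^esub> f\<^sub>0 a)"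
proof (intro bexI conjI)
  let ?g = "\<lambda>a. f (cut essential a)"
  show "\<forall>a\<in>carrier P. f a = ?g a \<oplus>\<^bsub>B\<^esub> f (cut (I - essential) a)" using f_split by blast
  show "(\<lambda>a. f (cut (I - essential) a)) ` carrier P \<subseteq> Z"
    using f_cut_inessential_in_annihilator by blast
  \<comment> \<open>The map out of the finite subproduct is given by the same formula as
    \<open>?g\<close>, because \<open>cut essential\<close> ignores all other coordinates.\<close>
  have "cut essential (restrict a essential) = cut essential a" for a
    by (auto simp: cut_def)
  then show "\<exists>J g. J \<subseteq> I \<and> finite J \<and> g \<in> alg_hom R (alg_prod J A) B \<and>
      (\<forall>a\<in>carrier P. ?g a = g (restrict a J))"
    using essential_subset finite_essential f_cut_hom[of essential essential]
    by (intro exI[of _ essential] exI[of _ ?g]) simp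
qed (use f_cut_hom[of _ I] essential_subset in auto)

end

section \<open>The two cardinality alternatives\<close>

theorem theorem14:
  fixes R :: "('r, 'm) ring_scheme"
    and A :: "'i \<Rightarrow> ('r, 'a) module" and I :: "'i set"
    and B :: "('r, 'b) module" and f :: "('i \<Rightarrow> 'a) \<Rightarrow> 'b"
  assumes "valuation_ring R"
    and "infinite (carrier (residue_field R))"
    and "\<And>i. i \<in> I \<Longrightarrow> nonassoc_algebra R (A i)"
    and "nonassoc_algebra R B"
    and "torsion_free R B"
    and "f \<in> alg_hom R (alg_prod I A) B"
    and "f ` carrier (alg_prod I A) = carrier B"
    and "(module_rank R B <o |carrier (residue_field R)| \<and> |I| \<le>o |carrier (residue_field R)| ) \<or>
         (module_rank R B <o ctwo ^c natLeq \<and> |I| =o natLeq)"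
  shows "carrier B = f ` alg_fin I A <+>\<^bsub>B\<^esub> total_annihilator B \<and>
    (\<exists>f\<^sub>1 \<in> alg_hom R (alg_prod I A) B. \<exists>f\<^sub>0 \<in> alg_hom R (alg_prod I A) B.
       (\<exists>J g. J \<subseteq> I \<and> finite J \<and> g \<in> alg_hom R (alg_prod J A) B \<and>
          (\<forall>a\<in>carrier (alg_prod I A). f\<^sub>1 a = g (restrict a J))) \<and>
       f\<^sub>0 ` carrier (alg_prod I A) \<subseteq> total_annihilator B \<and>
       (\<forall>a\<in>carrier (alg_prod I A). f a = f\<^sub>1 a \<oplus>\<^bsub>B\<^esub> f\<^sub>0 a))"
proof -
  interpret V: valuation_ring R by (rule assms(1))
  interpret K: field "residue_field R" by (rule V.field_residue_field)
  interpret B: nonassoc_algebra R B by (rule assms(4))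
  \<comment> \<open>\<open>S\<close> is the very set picked in the definition of
    \<open>module_rank\<close>, hence the equality.\<close>
  obtain S where S: "max_lin_indep R B S" "module_rank R B = |S|"
    using someI_ex[OF ex_max_lin_indep[OF B.M.abelian_monoid_axioms, of R]]
    by (auto simp: module_rank_def)
  \<comment> \<open>It remains to supply an infinite index set larger than \<open>S\<close> with a
    cofinitely independent family: the residue field itself in the first case, all sets of naturals
    in the second.\<close>
  note scalars = V.ex_scalars_annihilating[OF assms(3-6) S(1)]
  have annihilating: "\<exists>u. (\<forall>i\<in>I. u i \<in> carrier R) \<and> finite {i\<in>I. u i \<notin> Units R} \<and>
      f (\<lambda>i\<in>I. u i \<odot>\<^bsub>A i\<^esub> a i) = \<zero>\<^bsub>B\<^esub>" if a: "a \<in> carrier (alg_prod I A)" for a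
    using assms(8)
  proof
    assume c: "module_rank R B <o |carrier (residue_field R)| \<and> |I| \<le>o |carrier (residue_field R)|"
    then obtain p where "inj_on p I" "p ` I \<subseteq> carrier (residue_field R)"
      using card_of_ordLeq[of I "carrier (residue_field R)"] by auto
    then obtain v where v: "cofinitely_independent (residue_field R) (carrier (residue_field R)) I v"
      using K.ex_cofinitely_independent_carrier by blast
    show ?thesis by (rule scalars[OF _ assms(2) _ v a]) (use c S(2) in simp_all)
  next
    assume c: "module_rank R B <o ctwo ^c natLeq \<and> |I| =o natLeq"
    have "|I| \<le>o |UNIV :: nat set|"
      using c card_of_nat ordIso_symmetric ordIso_transitive ordIso_imp_ordLeq by blast
    then obtain e :: "'i \<Rightarrow> nat" where "inj_on e I" using card_of_ordLeq[of I UNIV] by auto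
    then obtain v where v: "cofinitely_independent (residue_field R) (UNIV :: nat set set) I v"
      using K.ex_cofinitely_independent_continuum[OF assms(2)] by blast
    have "|UNIV :: nat set set| =o ctwo ^c natLeq"
      using card_of_Pow_Func[of "UNIV :: nat set"] by (simp add: cexp_def ctwo_def Field_natLeq)
    then have "|S| <o |UNIV :: nat set set|"
      using c S(2) ordIso_symmetric ordLess_ordIso_trans by metis
    moreover have "infinite (UNIV :: nat set set)" by (simp add: Finite_Set.finite_set)
    ultimately show ?thesis by (intro scalars[OF _ _ _ v a])
  qed
  interpret product_algebra_epi R A I B f
    by (intro product_algebra_epi.intro V.is_cring assms annihilating)
  show ?thesis by (intro conjI carrier_decomposition f_decomposition)
qed

end
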